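(* Let $k\ge1$ be an integer and $T\subset\mathbb{R}^3$ a tetrahedron. The following degrees of freedom are unisolvent on $\mathrm{P}_k(T)\otimes\mathbb{S}_3$: for $\sigma\in\mathrm{P}_k(T)\otimes\mathbb{S}_3$, - $\sigma(x)$ at each vertex $x$ of $T$; - $\int_e\sigma:p$ for $p\in\mathrm{P}_{k-2}(e)\otimes\mathbb{S}_3$, for each edge $e$ of $T$; - $\int_f(\Pi_f\sigma\Pi_f):b$ for $b\in\mathrm{P}_{k-3}(f)\otimes\mathbb{S}(f)$, for each face $f$ of $T$; - $\int_f(\mathrm{tr}\,\sigma)\,p$ for $p\in\mathrm{P}_{k-3}(f)$, for each face $f$ of $T$; - $\int_T\sigma:b$ for $b\in\widetilde{B}(T)$.
   Context: $\mathrm{P}_m(s)$: polynomials of degree at most $m$ on a simplex $s$ (zero space if $m<0$). $\mathbb{S}_3$: real symmetric $3\times3$ matrices; $A:B=\sum_{ij}A_{ij}B_{ij}$. For a face $f$, $\Pi_f$ is the orthogonal projection of $\mathbb{R}^3$ onto the tangent plane of $f$, and $\mathbb{S}(f)$ is the span of the matrices $uv^T+vu^T$ with $u,v$ tangent to $f$. $\widetilde{B}(T)$ is the space of $\sigma\in\mathrm{P}_k(T)\otimes\mathbb{S}_3$ such that $\Pi_f\sigma\Pi_f=0$ on $f$ for each face $f$ of $T$, $\mathrm{tr}\,\sigma=0$ on $\partial T$, and $\sigma|_e=0$ for every edge $e$ of $T$. Unisolvent means: the listed linear forms (with $p,b$ ranging over bases of the indicated spaces) form a basis of the dual of $\mathrm{P}_k(T)\otimes\mathbb{S}_3$.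 *)

theory Defs
  imports "HOL-Analysis.Analysis" "HOL-Library.Function_Algebras"
begin

text \<open>Pointwise real vector space structure on functions; it makes \<^const>\<open>span\<close> and
  \<^const>\<open>independent\<close> available for spaces of fields and of linear forms.\<close>

instantiation "fun" :: (type, real_vector) real_vector
begin

definition scaleR_fun_def: "scaleR c f = (\<lambda>x. c *\<^sub>R f x)"

instance
  by standard (simp_all add: scaleR_fun_def fun_eq_iff algebra_simps)

end

definition basis_of :: "'v::real_vector set \<Rightarrow> 'v set \<Rightarrow> bool" where
  "basis_of B V \<longleftrightarrow> independent B \<and> span B = V"

text \<open>The dual of a subspace \<open>V\<close>: real linear forms on \<open>V\<close>, represented by functions on the whole
  type that vanish off \<open>V\<close>, so that equality of forms is equality on \<open>V\<close>.\<close>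

definition dual_space :: "'v::real_vector set \<Rightarrow> ('v \<Rightarrow> real) set" where
  "dual_space V = {l. (\<forall>x\<in>V. \<forall>y\<in>V. l (x + y) = l x + l y) \<and>
     (\<forall>c. \<forall>x\<in>V. l (c *\<^sub>R x) = c * l x) \<and> (\<forall>x. x \<notin> V \<longrightarrow> l x = 0)}"

definition form_on :: "'v::real_vector set \<Rightarrow> ('v \<Rightarrow> real) \<Rightarrow> 'v \<Rightarrow> real" where
  "form_on V l = (\<lambda>x. if x \<in> V then l x else 0)"

text \<open>A family \<open>(l i)\<close>, \<open>i \<in> I\<close>, is a basis as a family: no form is listed twice.\<close>

definition unisolvent :: "'i set \<Rightarrow> ('i \<Rightarrow> 'v::real_vector \<Rightarrow> real) \<Rightarrow> 'v set \<Rightarrow> bool" where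
  "unisolvent I l V \<longleftrightarrow>
     inj_on (\<lambda>i. form_on V (l i)) I \<and> basis_of ((\<lambda>i. form_on V (l i)) ` I) (dual_space V)"

text \<open>\<open>P\<^sub>m(s)\<close>: functions on \<open>s\<close>, extended by zero off \<open>s\<close>. On a simplex of lower dimension, the
  polynomials of degree at most \<open>m\<close> are the restrictions of those on the ambient space. For
  \<open>m < 0\<close> there are no monomials and the span is the zero space.\<close>

definition polys :: "int \<Rightarrow> (real^3) set \<Rightarrow> (real^3 \<Rightarrow> real) set" where
  "polys m s = span {\<lambda>x. if x \<in> s then \<Prod>i\<in>UNIV. (x $ i) ^ \<alpha> i else 0 | \<alpha> :: 3 \<Rightarrow> nat.
     int (\<Sum>i\<in>UNIV. \<alpha> i) \<le> m}"

definition polys_tensor :: "int \<Rightarrow> (real^3) set \<Rightarrow> (real^3^3) set \<Rightarrow> (real^3 \<Rightarrow> real^3^3) set" where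
  "polys_tensor m s X = span {\<lambda>x. p x *\<^sub>R A | p A. p \<in> polys m s \<and> A \<in> X}"

definition sym3 :: "(real^3^3) set" where
  "sym3 = {A. transpose A = A}"

definition tangent :: "(real^3) set \<Rightarrow> (real^3) set" where
  "tangent s = span {x - y | x y. x \<in> s \<and> y \<in> s}"

definition tangent_proj :: "(real^3) set \<Rightarrow> real^3^3" where
  "tangent_proj f = (THE P. \<forall>x. P *v x \<in> tangent f \<and> (\<forall>y\<in>tangent f. orthogonal (x - P *v x) y))"

definition sym_tangent :: "(real^3) set \<Rightarrow> (real^3^3) set" where
  "sym_tangent f =
     span {(\<chi> i j. u $ i * v $ j + v $ i * u $ j) | u v. u \<in> tangent f \<and> v \<in> tangent f}"

text \<open>Arc length and surface integrals over a flat piece: Lebesgue integration after identifying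
  the affine hull isometrically with a Euclidean space. The value does not depend on the isometry,
  as two of them differ by an isometry of that Euclidean space.\<close>

definition flat_chart :: "(real^3) set \<Rightarrow> ('d::euclidean_space \<Rightarrow> real^3) \<Rightarrow> bool" where
  "flat_chart s \<phi> \<longleftrightarrow> (\<forall>x y. dist (\<phi> x) (\<phi> y) = dist x y) \<and> range \<phi> = affine hull s"

lemma ex_flat_chart:
  fixes s :: "(real^3) set"
  assumes "aff_dim s = int DIM('d::euclidean_space)"
  shows "\<exists>\<phi> :: 'd \<Rightarrow> real^3. flat_chart s \<phi>"
proof -
  have "s \<noteq> {}" using assms by auto
  then obtain a where a: "a \<in> s" by blast
  then have a': "a \<in> affine hull s" by (rule hull_inc)
  define U where "U = span ((+) (- a) ` s)"
  have hull: "affine hull s = (+) a ` U"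
    unfolding U_def using affine_hull_span_gen[OF a'] by simp
  have "dim U = DIM('d)"
    unfolding U_def using aff_dim_eq_dim[OF a'] assms by simp
  then obtain g :: "'d \<Rightarrow> real^3" and h where g: "linear g" "g ` UNIV = U" "\<And>x. norm (g x) = norm x"
    using isometries_subspaces[of "UNIV :: 'd set" U]
    by (metis U_def UNIV_I dim_UNIV subspace_UNIV subspace_span)
  have "dist (a + g x) (a + g y) = dist x y" for x y
    by (simp add: dist_norm flip: linear_diff[OF g(1)] g(3))
  moreover have "range (\<lambda>x. a + g x) = affine hull s"
    using g(2) hull by auto
  ultimately show ?thesis
    unfolding flat_chart_def by (intro exI[of _ "\<lambda>x. a + g x"]) simp
qed

definition edge_integral :: "(real^3) set \<Rightarrow> (real^3 \<Rightarrow> real) \<Rightarrow> real" where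
  "edge_integral e g = (let \<phi> = (SOME \<phi> :: real \<Rightarrow> real^3. flat_chart e \<phi>)
     in LINT t : \<phi> -` e | lborel. g (\<phi> t))"

definition face_integral :: "(real^3) set \<Rightarrow> (real^3 \<Rightarrow> real) \<Rightarrow> real" where
  "face_integral f g = (let \<phi> = (SOME \<phi> :: real^2 \<Rightarrow> real^3. flat_chart f \<phi>)
     in LINT t : \<phi> -` f | lborel. g (\<phi> t))"

definition bubbles :: "int \<Rightarrow> (real^3) set \<Rightarrow> (real^3 \<Rightarrow> real^3^3) set" where
  "bubbles k T = {\<sigma> \<in> polys_tensor k T sym3.
     (\<forall>f. f facet_of T \<longrightarrow> (\<forall>x\<in>f. tangent_proj f ** \<sigma> x ** tangent_proj f = 0)) \<and>
     (\<forall>x\<in>frontier T. trace (\<sigma> x) = 0) \<and>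
     (\<forall>e. e edge_of T \<longrightarrow> (\<forall>x\<in>e. \<sigma> x = 0))}"

datatype dof =
    Vertex "real^3" "real^3^3"
  | Edge "(real^3) set" "real^3 \<Rightarrow> real^3^3"
  | Face "(real^3) set" "real^3 \<Rightarrow> real^3^3"
  | FaceTrace "(real^3) set" "real^3 \<Rightarrow> real"
  | Interior "real^3 \<Rightarrow> real^3^3"

text \<open>The inner product of \<^typ>\<open>real^3^3\<close> is the contraction \<open>A : B\<close>. A vertex value \<open>\<sigma>(x)\<close> gives
  six scalar forms, its coordinates \<open>\<sigma>(x) : S\<close> against a basis of the symmetric matrices.\<close>

fun dof_form :: "(real^3) set \<Rightarrow> dof \<Rightarrow> (real^3 \<Rightarrow> real^3^3) \<Rightarrow> real" where
  "dof_form T (Vertex x S) \<sigma> = \<sigma> x \<bullet> S"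
| "dof_form T (Edge e p) \<sigma> = edge_integral e (\<lambda>x. \<sigma> x \<bullet> p x)"
| "dof_form T (Face f b) \<sigma> =
     face_integral f (\<lambda>x. (tangent_proj f ** \<sigma> x ** tangent_proj f) \<bullet> b x)"
| "dof_form T (FaceTrace f p) \<sigma> = face_integral f (\<lambda>x. trace (\<sigma> x) * p x)"
| "dof_form T (Interior b) \<sigma> = (LINT x : T | lborel. \<sigma> x \<bullet> b x)"

definition dofs :: "(real^3) set \<Rightarrow> (real^3 \<Rightarrow> (real^3^3) set) \<Rightarrow>
    ((real^3) set \<Rightarrow> (real^3 \<Rightarrow> real^3^3) set) \<Rightarrow> ((real^3) set \<Rightarrow> (real^3 \<Rightarrow> real^3^3) set) \<Rightarrow>
    ((real^3) set \<Rightarrow> (real^3 \<Rightarrow> real) set) \<Rightarrow> (real^3 \<Rightarrow> real^3^3) set \<Rightarrow> dof set" where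
  "dofs T BV BE BF BR BT =
     {Vertex x S | x S. x extreme_point_of T \<and> S \<in> BV x} \<union>
     {Edge e p | e p. e edge_of T \<and> p \<in> BE e} \<union>
     {Face f b | f b. f facet_of T \<and> b \<in> BF f} \<union>
     {FaceTrace f p | f p. f facet_of T \<and> p \<in> BR f} \<union>
     {Interior b | b. b \<in> BT}"

end

theory Submission
  imports Defs
begin

text \<open>Write \<open>\<lambda>\<^sub>v\<close> for the barycentric coordinates and \<open>b\<^sub>S = \<Prod>\<^bsub>v\<in>S\<^esub> \<lambda>\<^sub>v\<close>. A polynomial of degree at most \<open>m\<close> that
  vanishes on the boundary of the simplex with vertex set \<open>S\<close> is \<open>b\<^sub>S q\<close> there with \<open>q\<close> of degree
  at most \<open>m - |S|\<close>. If all degrees of freedom of \<open>\<sigma>\<close> vanish, then \<open>\<sigma>\<close> is zero at the vertices, so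
  \<open>\<sigma> = b\<^sub>S q\<close> on each edge, and testing against \<open>q\<close> gives \<open>\<integral> b\<^sub>S |q|\<^sup>2 = 0\<close>, hence \<open>\<sigma> = 0\<close> on
  edges. The same argument applies on faces to the tangential part and to the trace, so \<open>\<sigma>\<close> is a
  bubble orthogonal to all bubbles. For independence, evaluate a vanishing combination of the forms
  in the order interior, faces, edges, vertices, at the fields \<open>b\<^sub>S M\<close> with \<open>M\<close> built from the
  coefficients on \<open>S\<close>: they have no other degrees of freedom of equal or lower dimension, and again
  a weighted \<open>L\<^sup>2\<close> norm must vanish. No dimension count is needed.\<close>

section \<open>Polynomials on subsets of space\<close>

text \<open>Division by \<open>bub S\<close> has to work on edges and faces, where a polynomial does
  not determine its extension to space. The algebra is therefore done with representatives on the
  whole space, and identities are asserted on convex hulls. The factor \<open>lam v\<close> comes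
  from the fact that \<open>p x - p (x - l x *\<^sub>R w)\<close> is a multiple of the affine
  function \<open>l\<close> for every vector \<open>w\<close>: if \<open>l\<close> is
  \<open>lam v\<close> and \<open>w\<close> is the difference of \<open>v\<close> and another
  vertex, the shift maps the simplex into the face opposite \<open>v\<close>, where \<open>p\<close>
  vanishes.

  On a face the tangential part and the trace belong to the same field, so their forms have to be
  decoupled. The matrix N = n n^T / |n|^2, with n normal to the face, has zero tangential part and
  trace one; adding a multiple of it adjusts the trace and leaves the tangential part alone.

  The passage from a trivial common kernel to a spanning family is the algebraic fact that a linear
  form vanishing on the common kernel of finitely many forms is a combination of them.\<close>

lemma scaleR_fun_apply [simp]: "(c *\<^sub>R f) x = c *\<^sub>R f x"
  by (simp add: scaleR_fun_def)

lemma sum_fun_apply: "(\<Sum>i\<in>A. f i) x = (\<Sum>i\<in>A. f i x)"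
  by (induction A rule: infinite_finite_induct) auto

definition restr :: "'a set \<Rightarrow> ('a \<Rightarrow> 'b::real_vector) \<Rightarrow> 'a \<Rightarrow> 'b" where
  "restr s f = (\<lambda>x. if x \<in> s then f x else 0)"

lemma linear_restr: "linear (restr s)"
  by (rule linearI) (auto simp: restr_def fun_eq_iff)

definition monom3 :: "(3 \<Rightarrow> nat) \<Rightarrow> real^3 \<Rightarrow> real" where
  "monom3 \<alpha> x = (\<Prod>i\<in>UNIV. (x $ i) ^ \<alpha> i)"

lemma polys_alt: "polys m s = restr s ` span {monom3 \<alpha> | \<alpha>. int (\<Sum>i\<in>UNIV. \<alpha> i) \<le> m}"
  unfolding linear_span_image[OF linear_restr, symmetric] polys_def
  by (rule arg_cong[of _ _ span]) (auto simp: restr_def monom3_def image_def fun_eq_iff)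

lemma polys_UNIV: "polys m UNIV = span {monom3 \<alpha> | \<alpha>. int (\<Sum>i\<in>UNIV. \<alpha> i) \<le> m}"
  unfolding polys_alt by (simp add: restr_def)

text \<open>Extension by zero is linear, so it commutes with \<open>span\<close>. The representative
  in \<open>polys m UNIV\<close> need not be unique when \<open>s\<close> is flat.\<close>

lemma polys_restr: "polys m s = restr s ` polys m UNIV"
  unfolding polys_alt[of m s] polys_UNIV ..

lemma subspace_polys: "subspace (polys m s)"
  unfolding polys_def by (rule subspace_span)

lemma polys_add: "p \<in> polys m s \<Longrightarrow> q \<in> polys m s \<Longrightarrow> (\<lambda>x. p x + q x) \<in> polys m s"
  using subspace_add[OF subspace_polys, of p m s q] by (simp add: plus_fun_def)

lemma polys_cmult: "p \<in> polys m s \<Longrightarrow> (\<lambda>x. c * p x) \<in> polys m s"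
  using subspace_scale[OF subspace_polys, of p m s c] by (simp add: scaleR_fun_def)

lemma polys_diff: "p \<in> polys m s \<Longrightarrow> q \<in> polys m s \<Longrightarrow> (\<lambda>x. p x - q x) \<in> polys m s"
  using polys_add[of p m s "\<lambda>x. -1 * q x"] polys_cmult[of q m s "-1"] by simp

lemma polys_0: "(\<lambda>x. 0) \<in> polys m s"
  using subspace_0[OF subspace_polys, of m s] by (simp add: zero_fun_def)

lemma polys_sum: "(\<And>i. i \<in> I \<Longrightarrow> p i \<in> polys m s) \<Longrightarrow> (\<lambda>x. \<Sum>i\<in>I. p i x) \<in> polys m s"
  by (induction I rule: infinite_finite_induct) (auto intro: polys_add polys_0)

lemma polys_mono: "m \<le> n \<Longrightarrow> polys m s \<subseteq> polys n s"
  unfolding polys_alt by (intro image_mono span_mono) auto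

lemma monom3_in_polys: "int (\<Sum>i\<in>UNIV. \<alpha> i) \<le> m \<Longrightarrow> monom3 \<alpha> \<in> polys m UNIV"
  unfolding polys_UNIV by (auto intro!: span_base)

lemma polys_induct [consumes 1, case_names zero add monom]:
  assumes "p \<in> polys m UNIV"
    and "Q (\<lambda>x. 0)"
    and "\<And>c p q. Q p \<Longrightarrow> Q q \<Longrightarrow> Q (\<lambda>x. c * p x + q x)"
    and "\<And>\<alpha>. int (\<Sum>i\<in>UNIV. \<alpha> i) \<le> m \<Longrightarrow> Q (monom3 \<alpha>)"
  shows "Q p"
  using assms(1) unfolding polys_UNIV
proof (induction rule: span_induct_alt)
  case base
  then show ?case using assms(2) by (simp add: zero_fun_def)
next
  case (step c x y)
  then show ?case using assms(3)[of x y c] assms(4)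
    by (auto simp: plus_fun_def scaleR_fun_def)
qed

lemma polys_mult:
  assumes "p \<in> polys a UNIV" "q \<in> polys b UNIV"
  shows "(\<lambda>x. p x * q x) \<in> polys (a + b) UNIV"
  using assms(1)
proof (induction rule: polys_induct)
  case zero
  then show ?case by (simp add: polys_0)
next
  case (add c p r)
  then show ?case
    using polys_add[OF polys_cmult[OF add(1), of c] add(2)] by (simp add: algebra_simps)
next
  case (monom \<alpha>)
  from assms(2) show ?case
  proof (induction rule: polys_induct)
    case zero
    then show ?case by (simp add: polys_0)
  next
    case (add c p r)
    then show ?case
      using polys_add[OF polys_cmult[OF add(1), of c] add(2)] by (simp add: algebra_simps)
  next
    case (monom \<beta>)
    have "(\<lambda>x. monom3 \<alpha> x * monom3 \<beta> x) = monom3 (\<lambda>i. \<alpha> i + \<beta> i)"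
      by (simp add: monom3_def fun_eq_iff power_add prod.distrib)
    then show ?case using monom \<open>int (sum \<alpha> UNIV) \<le> a\<close>
      by (auto intro!: monom3_in_polys simp: sum.distrib)
  qed
qed

lemma polys_const: "0 \<le> m \<Longrightarrow> (\<lambda>x. c) \<in> polys m UNIV"
  using polys_cmult[OF monom3_in_polys[of "\<lambda>_. 0" m], of c] by (simp add: monom3_def)

lemma monom3_upd: "x $ i * monom3 \<alpha> x = monom3 (\<alpha>(i := Suc (\<alpha> i))) x"
proof -
  have "(\<Prod>j\<in>UNIV - {i}. (x $ j) ^ (\<alpha>(i := Suc (\<alpha> i))) j) = (\<Prod>j\<in>UNIV - {i}. (x $ j) ^ \<alpha> j)"
    by (rule prod.cong) auto
  then show ?thesis
    by (simp add: monom3_def prod.remove[of UNIV i] del: fun_upd_apply) simp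
qed

lemma sum_upd_Suc: "(\<Sum>j\<in>UNIV. (\<alpha>(i := Suc (\<alpha> i))) j) = Suc (\<Sum>j\<in>UNIV. \<alpha> (j::3))"
proof -
  have "(\<Sum>j\<in>UNIV - {i}. (\<alpha>(i := Suc (\<alpha> i))) j) = (\<Sum>j\<in>UNIV - {i}. \<alpha> j)"
    by (rule sum.cong) auto
  then show ?thesis
    by (simp add: sum.remove[of UNIV i] del: fun_upd_apply) simp
qed

lemma polys_coord: "(\<lambda>x. x $ i) \<in> polys 1 UNIV"
proof -
  have "(\<lambda>x. x $ i) = monom3 ((\<lambda>_. 0)(i := Suc 0))"
    using monom3_upd[of _ i "\<lambda>_. 0"] by (simp add: monom3_def fun_eq_iff)
  moreover have "(\<Sum>j\<in>UNIV. ((\<lambda>_::3. 0)(i := Suc 0)) j) = 1"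
    using sum_upd_Suc[of "\<lambda>_. 0" i] by simp
  ultimately show ?thesis by (metis monom3_in_polys of_nat_1 order_refl)
qed

lemma polys_affine:
  fixes g :: "real^3 \<Rightarrow> real"
  assumes "linear g"
  shows "(\<lambda>x. g x + c) \<in> polys 1 UNIV"
proof -
  have "g x = (\<Sum>i\<in>UNIV. g (axis i 1) * x $ i)" for x
  proof -
    have "g x = g (\<Sum>i\<in>UNIV. x $ i *\<^sub>R axis i 1)"
      using basis_expansion[of x] by (simp add: scalar_mult_eq_scaleR)
    also have "\<dots> = (\<Sum>i\<in>UNIV. g (axis i 1) * x $ i)"
      by (simp only: linear_sum[OF assms] linear_scale[OF assms] real_scaleR_def mult.commute)
    finally show ?thesis .
  qed
  then have "g = (\<lambda>x. \<Sum>i\<in>UNIV. g (axis i 1) * x $ i)" by (rule ext)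
  moreover have "(\<lambda>x. \<Sum>i\<in>UNIV. g (axis i 1) * x $ i) \<in> polys 1 UNIV"
    by (intro polys_sum polys_cmult polys_coord)
  ultimately have "g \<in> polys 1 UNIV" by metis
  then show ?thesis using polys_add polys_const[of 1 c] by auto
qed

lemma continuous_on_polys: "p \<in> polys m UNIV \<Longrightarrow> continuous_on A p"
proof (induction rule: polys_induct)
  case (monom \<alpha>)
  then show ?case unfolding monom3_def[abs_def] by (intro continuous_intros)
qed (auto intro!: continuous_intros)

text \<open>Builds a monomial from 1 by one coordinate factor at a time. The degree is an argument
  of \<open>Q\<close> because the division property bounds the degree of the quotient by that of the
  dividend.\<close>

lemma monom3_induct [case_names one step]:
  assumes "Q 0 (\<lambda>x. 1)" "\<And>n p i. Q n p \<Longrightarrow> Q (Suc n) (\<lambda>x. x $ i * p x)"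
  shows "Q (\<Sum>i\<in>UNIV. \<alpha> i) (monom3 \<alpha>)"
proof (induction "\<Sum>i\<in>UNIV. \<alpha> i" arbitrary: \<alpha>)
  case 0
  then have "\<alpha> = (\<lambda>_. 0)" by (auto simp: fun_eq_iff)
  then show ?case using assms(1) by (simp add: monom3_def[abs_def])
next
  case (Suc n)
  then obtain i where "\<alpha> i \<noteq> 0" by (metis nat.distinct(1) sum.neutral)
  define \<beta> where "\<beta> = \<alpha>(i := \<alpha> i - 1)"
  have a: "\<alpha> = \<beta>(i := Suc (\<beta> i))" using \<open>\<alpha> i \<noteq> 0\<close> by (auto simp: \<beta>_def fun_eq_iff)
  have b: "Suc (\<Sum>i\<in>UNIV. \<beta> i) = (\<Sum>i\<in>UNIV. \<alpha> i)" by (subst a) (rule sum_upd_Suc[symmetric])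
  with Suc have "Q (\<Sum>i\<in>UNIV. \<beta> i) (monom3 \<beta>)" by simp
  from assms(2)[OF this, of i] show ?case
    unfolding monom3_upd a[symmetric] b .
qed

text \<open>A factor theorem along the direction \<open>w\<close>: the shift changes the coordinate
  \<open>x $ i\<close> by \<open>l x * w $ i\<close>, a multiple of \<open>l\<close>, and the
  product rule for differences passes divisibility on to monomials. The vector \<open>w\<close> is
  free; its choice later decides where the shifted point lies.\<close>

lemma polys_division:
  assumes l: "l \<in> polys 1 UNIV" and p: "p \<in> polys m UNIV"
  shows "\<exists>q\<in>polys (m - 1) UNIV. \<forall>x. p x - p (x - l x *\<^sub>R w) = l x * q x"
  using p
proof (induction rule: polys_induct)
  case zero
  then show ?case using polys_0 by fastforce
next
  case (add c p r)
  then obtain q q' where q: "q \<in> polys (m - 1) UNIV" "q' \<in> polys (m - 1) UNIV"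
    and e: "\<And>x. p x - p (x - l x *\<^sub>R w) = l x * q x" "\<And>x. r x - r (x - l x *\<^sub>R w) = l x * q' x"
    by blast
  have "c * p x + r x - (c * p (x - l x *\<^sub>R w) + r (x - l x *\<^sub>R w)) = l x * (c * q x + q' x)" for x
  proof -
    have "p x = p (x - l x *\<^sub>R w) + l x * q x" "r x = r (x - l x *\<^sub>R w) + l x * q' x"
      using e[of x] by simp_all
    then show ?thesis by (simp only: ) (simp add: algebra_simps)
  qed
  with polys_add[OF polys_cmult[OF q(1), of c] q(2)] show ?case
    by (intro bexI[where x = "\<lambda>x. c * q x + q' x"] allI)
next
  case (monom \<alpha>)
  \<comment> \<open>The first conjunct feeds the product step: the shift is an affine map, so
    composing with it keeps the degree.\<close>
  define Q where "Q n p \<longleftrightarrow> (\<lambda>x. p (x - l x *\<^sub>R w)) \<in> polys (int n) UNIV \<and>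
     (\<exists>q\<in>polys (int n - 1) UNIV. \<forall>x. p x - p (x - l x *\<^sub>R w) = l x * q x)" for n p
  have "Q (\<Sum>i\<in>UNIV. \<alpha> i) (monom3 \<alpha>)"
  proof (induction rule: monom3_induct)
    case one
    \<comment> \<open>For a constant the difference is zero, and the quotient lives in degree -1,
      that is, in the zero space.\<close>
    then show ?case using polys_0 by (fastforce simp: Q_def polys_const)
  next
    case (step n p i)
    then obtain q where p: "(\<lambda>x. p (x - l x *\<^sub>R w)) \<in> polys (int n) UNIV"
      and q: "q \<in> polys (int n - 1) UNIV" and e: "\<And>x. p x - p (x - l x *\<^sub>R w) = l x * q x"
      unfolding Q_def by blast
    have "(\<lambda>x. x $ i - w $ i * l x) \<in> polys 1 UNIV"
      by (intro polys_diff polys_cmult polys_coord l)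
    from polys_mult[OF this p]
    have 1: "(\<lambda>x. (x - l x *\<^sub>R w) $ i * p (x - l x *\<^sub>R w)) \<in> polys (int (Suc n)) UNIV"
      by (simp add: mult.commute add.commute)
    have 2: "(\<lambda>x. x $ i * q x + w $ i * p (x - l x *\<^sub>R w)) \<in> polys (int (Suc n) - 1) UNIV"
      using polys_mult[OF polys_coord[of i] q] p by (intro polys_add polys_cmult) auto
    \<comment> \<open>With x' the shifted point, this is x_i p(x) - x'_i p(x') = x_i (p(x) - p(x'))
      + (x_i - x'_i) p(x').\<close>
    have 3: "x $ i * p x - (x - l x *\<^sub>R w) $ i * p (x - l x *\<^sub>R w)
        = l x * (x $ i * q x + w $ i * p (x - l x *\<^sub>R w))" for x
    proof -
      have "p x = p (x - l x *\<^sub>R w) + l x * q x" using e[of x] by simp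
      then show ?thesis by (simp only: ) (simp add: algebra_simps)
    qed
    show ?case unfolding Q_def
      by (intro conjI bexI[where x = "\<lambda>x. x $ i * q x + w $ i * p (x - l x *\<^sub>R w)"] allI 1 2 3)
  qed
  then show ?case unfolding Q_def using polys_mono[of "int (sum \<alpha> UNIV) - 1" "m - 1" UNIV] monom by auto
qed

section \<open>Matrix-valued polynomials and division by barycentric coordinates\<close>

lemma polys_tensor_restr: "polys_tensor m s X = restr s ` polys_tensor m UNIV X"
  unfolding linear_span_image[OF linear_restr, symmetric] polys_tensor_def
proof (rule arg_cong[of _ _ span], intro set_eqI iffI)
  fix F assume "F \<in> {\<lambda>x. p x *\<^sub>R A |p A. p \<in> polys m s \<and> A \<in> X}"
  then obtain p A where "F = (\<lambda>x. restr s p x *\<^sub>R A)" "p \<in> polys m UNIV" "A \<in> X"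
    unfolding polys_restr[of m s] by blast
  then show "F \<in> restr s ` {\<lambda>x. p x *\<^sub>R A |p A. p \<in> polys m UNIV \<and> A \<in> X}"
    by (intro image_eqI[where x = "\<lambda>x. p x *\<^sub>R A"]) (auto simp: restr_def)
next
  fix F assume "F \<in> restr s ` {\<lambda>x. p x *\<^sub>R A |p A. p \<in> polys m UNIV \<and> A \<in> X}"
  then obtain p A where F: "F = restr s (\<lambda>x. p x *\<^sub>R A)" "p \<in> polys m UNIV" "A \<in> X"
    by blast
  have "F = (\<lambda>x. restr s p x *\<^sub>R A)" by (auto simp: F(1) restr_def)
  then show "F \<in> {\<lambda>x. p x *\<^sub>R A |p A. p \<in> polys m s \<and> A \<in> X}"
    unfolding polys_restr[of m s] using F by blast
qed

lemma subspace_polys_tensor: "subspace (polys_tensor m s X)"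
  unfolding polys_tensor_def by (rule subspace_span)

lemma polys_tensor_UNIV_D:
  assumes "subspace X" "F \<in> polys_tensor m UNIV X"
  shows "(\<lambda>x. F x \<bullet> A) \<in> polys m UNIV" "F x \<in> X"
proof -
  have "(\<forall>A. (\<lambda>x. F x \<bullet> A) \<in> polys m UNIV) \<and> (\<forall>x. F x \<in> X)"
    using assms(2) unfolding polys_tensor_def
  proof (induction rule: span_induct_alt)
    case base
    then show ?case using polys_0 subspace_0[OF assms(1)] by simp
  next
    case (step c F G)
    then obtain p B where F: "F = (\<lambda>x. p x *\<^sub>R B)" "p \<in> polys m UNIV" "B \<in> X" by blast
    have "(\<lambda>x. (c *\<^sub>R F + G) x \<bullet> A) \<in> polys m UNIV" for A
    proof -
      have "(\<lambda>x. (c * (B \<bullet> A)) * p x + G x \<bullet> A) \<in> polys m UNIV"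
        using step(2) F by (intro polys_add polys_cmult) auto
      then show ?thesis by (simp add: F(1) inner_add_left mult_ac)
    qed
    moreover have "(c *\<^sub>R F + G) x \<in> X" for x
      using step(2) F assms(1) by (simp add: subspace_add subspace_scale)
    ultimately show ?case by blast
  qed
  then show "(\<lambda>x. F x \<bullet> A) \<in> polys m UNIV" "F x \<in> X" by auto
qed

lemma subspace_projection:
  fixes X :: "'a::real_vector set"
  assumes "subspace X"
  obtains g where "linear g" "\<And>x. g x \<in> X" "\<And>x. x \<in> X \<Longrightarrow> g x = x"
proof -
  obtain B where B: "B \<subseteq> X" "independent B" "X \<subseteq> span B" by (rule maximal_independent_subset)
  then have sp: "span B = X" using span_minimal[OF B(1) assms] by auto
  obtain g where g: "linear g" "\<forall>x\<in>B. g x = id x" "range g = span (id ` B)"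
    using linear_independent_extend_subspace[OF B(2), of id] by blast
  have "g x = x" if "x \<in> X" for x
    using linear_eq_on[OF g(1) linear_id, of x B] that g(2) sp by auto
  moreover have "g x \<in> X" for x using g(3) sp by auto
  ultimately show ?thesis using that g(1) by blast
qed

text \<open>Expanding \<open>F x\<close> in the standard basis gives polynomial coefficients, but in
  general the basis matrices lie outside \<open>X\<close>. A linear projection onto \<open>X\<close>
  fixes \<open>F x\<close> and moves these matrices into \<open>X\<close>.\<close>

lemma polys_tensor_UNIV_I:
  assumes "subspace X" "\<And>A. A \<in> Basis \<Longrightarrow> (\<lambda>x. F x \<bullet> A) \<in> polys m UNIV" "\<And>x. F x \<in> X"
  shows "F \<in> polys_tensor m UNIV X"
proof -
  obtain g where g: "linear g" "\<And>x. g x \<in> X" "\<And>x. x \<in> X \<Longrightarrow> g x = x"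
    using subspace_projection[OF assms(1)] by blast
  have "F x = (\<Sum>b\<in>Basis. (F x \<bullet> b) *\<^sub>R g b)" for x
  proof -
    have "F x = g (\<Sum>b\<in>Basis. (F x \<bullet> b) *\<^sub>R b)"
      using g(3)[OF assms(3)] by (simp add: euclidean_representation)
    also have "\<dots> = (\<Sum>b\<in>Basis. (F x \<bullet> b) *\<^sub>R g b)"
      by (simp only: linear_sum[OF g(1)] linear_scale[OF g(1)])
    finally show ?thesis .
  qed
  then have "F = (\<Sum>b\<in>Basis. (\<lambda>x. (F x \<bullet> b) *\<^sub>R g b))" 
    by (intro ext) (simp only: sum_fun_apply)
  moreover have "(\<Sum>b\<in>Basis. (\<lambda>x. (F x \<bullet> b) *\<^sub>R g b)) \<in> polys_tensor m UNIV X"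
  proof (rule subspace_sum[OF subspace_polys_tensor])
    fix b :: "real^3^3" assume "b \<in> Basis"
    then show "(\<lambda>x. (F x \<bullet> b) *\<^sub>R g b) \<in> polys_tensor m UNIV X"
      unfolding polys_tensor_def
      using assms(2)[OF \<open>b \<in> Basis\<close>] g(2)[of b]
      by (intro span_base CollectI exI[of _ "\<lambda>x. F x \<bullet> b"] exI[of _ "g b"]) auto
  qed
  ultimately show ?thesis by metis
qed

lemma polys_tensor_mult:
  assumes X: "subspace X" and p: "p \<in> polys a UNIV" and F: "F \<in> polys_tensor b UNIV X"
  shows "(\<lambda>x. p x *\<^sub>R F x) \<in> polys_tensor (a + b) UNIV X"
proof (rule polys_tensor_UNIV_I[OF X])
  show "(\<lambda>x. p x *\<^sub>R F x \<bullet> A) \<in> polys (a + b) UNIV" for A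
    using polys_mult[OF p polys_tensor_UNIV_D(1)[OF X F, of A]] by simp
  show "p x *\<^sub>R F x \<in> X" for x
    using polys_tensor_UNIV_D(2)[OF X F] X by (rule subspace_scale[rotated])
qed

lemma polys_tensor_mono: "m \<le> n \<Longrightarrow> X \<subseteq> Y \<Longrightarrow> polys_tensor m s X \<subseteq> polys_tensor n s Y"
  unfolding polys_tensor_def using polys_mono by (intro span_mono) blast

lemma continuous_on_polys_tensor:
  assumes "F \<in> polys_tensor m UNIV X"
  shows "continuous_on S F"
proof -
  have "F \<in> polys_tensor m UNIV UNIV" using assms polys_tensor_mono[of m m X UNIV] by auto
  then have "continuous_on S (\<lambda>x. F x \<bullet> A)" for A
    by (intro continuous_on_polys polys_tensor_UNIV_D(1)[OF subspace_UNIV])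
  then show ?thesis by (simp add: continuous_on_componentwise[of S F])
qed

text \<open>The functions \<open>lam v\<close> are affine on all of space, so that one family serves
  every face: a face is the hull of a subset \<open>S\<close> of \<open>C\<close>, and on it
  \<open>lam v\<close> vanishes for \<open>v\<close> outside \<open>S\<close>.\<close>

locale barycentric =
  fixes C :: "(real^3) set" and lam :: "real^3 \<Rightarrow> real^3 \<Rightarrow> real"
  assumes finite_vertices: "finite C"
    and lam_affine: "v \<in> C \<Longrightarrow> \<exists>g c. linear g \<and> (\<forall>x. lam v x = g x + c)"
    and lam_vertex: "v \<in> C \<Longrightarrow> w \<in> C \<Longrightarrow> lam v w = (if v = w then 1 else 0)"
begin

lemma lam_polys: "v \<in> C \<Longrightarrow> lam v \<in> polys 1 UNIV"
proof -
  assume "v \<in> C"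
  then obtain g c where "linear g" "lam v = (\<lambda>x. g x + c)" using lam_affine by blast
  then show ?thesis using polys_affine by metis
qed

lemma lam_segment: "v \<in> C \<Longrightarrow> lam v ((1 - t) *\<^sub>R x + t *\<^sub>R y) = (1 - t) * lam v x + t * lam v y"
  using lam_affine[of v] by (auto simp: linear_add linear_scale linear_diff algebra_simps)

text \<open>Weights that sum to one absorb the constant term of the affine function.\<close>

lemma lam_comb:
  assumes "v \<in> C" "S \<subseteq> C" "sum u S = 1"
  shows "lam v (\<Sum>w\<in>S. u w *\<^sub>R w) = (if v \<in> S then u v else 0)"
proof -
  obtain g c where g: "linear g" "\<And>x. lam v x = g x + c" using lam_affine[OF assms(1)] by blast
  have "finite S" using assms finite_vertices finite_subset by blast
  have "lam v (\<Sum>w\<in>S. u w *\<^sub>R w) = (\<Sum>w\<in>S. u w * g w) + (\<Sum>w\<in>S. u w) * c"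
    by (simp add: g(2) linear_sum[OF g(1)] linear_scale[OF g(1)] assms(3))
  also have "\<dots> = (\<Sum>w\<in>S. u w * lam v w)"
    by (simp add: g(2) algebra_simps sum.distrib sum_distrib_left)
  also have "\<dots> = (\<Sum>w\<in>S. if w = v then u v else 0)"
    using assms lam_vertex[OF assms(1)] by (intro sum.cong) auto
  finally show ?thesis using \<open>finite S\<close> by simp
qed

lemma hull_barycentric:
  assumes "S \<subseteq> C" "x \<in> convex hull S"
  shows "v \<in> C \<Longrightarrow> 0 \<le> lam v x" "v \<in> C \<Longrightarrow> v \<notin> S \<Longrightarrow> lam v x = 0"
    "(\<Sum>v\<in>S. lam v x) = 1" "(\<Sum>v\<in>S. lam v x *\<^sub>R v) = x"
proof -
  have "finite S" using assms finite_vertices finite_subset by blast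
  then obtain u where u: "\<And>v. v \<in> S \<Longrightarrow> 0 \<le> u v" "sum u S = 1" "x = (\<Sum>v\<in>S. u v *\<^sub>R v)"
    using assms(2) by (auto simp: convex_hull_finite)
  then have l: "lam v x = (if v \<in> S then u v else 0)" if "v \<in> C" for v
    using lam_comb[OF that assms(1)] by simp
  then show "v \<in> C \<Longrightarrow> 0 \<le> lam v x" "v \<in> C \<Longrightarrow> v \<notin> S \<Longrightarrow> lam v x = 0" using u by auto
  have e: "v \<in> S \<Longrightarrow> lam v x = u v" for v using l assms(1) by auto
  show "(\<Sum>v\<in>S. lam v x) = 1" using u(2) e by simp
  show "(\<Sum>v\<in>S. lam v x *\<^sub>R v) = x" using u(3) e by simp
qed

text \<open>\<open>W\<close> is kept apart from the simplex on which the product is studied: partial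
  products occur during division, and the bubble of one face is evaluated on others.\<close>

definition bub :: "(real^3) set \<Rightarrow> real^3 \<Rightarrow> real" where
  "bub W x = (\<Prod>v\<in>W. lam v x)"

lemma bub_polys: "W \<subseteq> C \<Longrightarrow> bub W \<in> polys (int (card W)) UNIV"
proof -
  assume "W \<subseteq> C"
  then have "finite W" using finite_vertices finite_subset by blast
  from this \<open>W \<subseteq> C\<close> show ?thesis
  proof (induction W rule: finite_induct)
    case empty
    then show ?case by (simp add: bub_def[abs_def] polys_const)
  next
    case (insert v W)
    then have "bub (insert v W) = (\<lambda>x. lam v x * bub W x)" by (auto simp: bub_def)
    then show ?case using polys_mult[OF lam_polys[of v] insert(3)] insert by simp
  qed
qed

lemma bub_nonneg: "W \<subseteq> C \<Longrightarrow> S \<subseteq> C \<Longrightarrow> x \<in> convex hull S \<Longrightarrow> 0 \<le> bub W x"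
  unfolding bub_def by (intro prod_nonneg ballI hull_barycentric(1)) auto

text \<open>A vertex of \<open>W\<close> outside \<open>S\<close> contributes a factor that is zero
  on the hull of \<open>S\<close>. This is what localizes the test fields.\<close>

lemma bub_zero: "W \<subseteq> C \<Longrightarrow> S \<subseteq> C \<Longrightarrow> \<not> W \<subseteq> S \<Longrightarrow> x \<in> convex hull S \<Longrightarrow> bub W x = 0"
  using finite_subset[OF _ finite_vertices, of W] hull_barycentric(2)[of S x]
  by (auto simp: bub_def prod_zero_iff)

text \<open>The points where \<open>bub W\<close> is nonzero are dense in the hull: moving from
  \<open>x\<close> by any positive amount towards the barycentre of \<open>S\<close> makes all
  factors positive. Applied with partial products to cancel factors during division, and with the
  full bubble to prove independence.\<close>

lemma bub_dense:
  fixes F :: "real^3 \<Rightarrow> 'b::real_normed_vector"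
  assumes W: "W \<subseteq> S" and S: "S \<subseteq> C" "S \<noteq> {}" and cont: "continuous_on (convex hull S) F"
    and z: "\<And>x. x \<in> convex hull S \<Longrightarrow> bub W x \<noteq> 0 \<Longrightarrow> F x = 0" and x: "x \<in> convex hull S"
  shows "F x = 0"
proof -
  have fS: "finite S" "card S > 0"
    using S finite_vertices finite_subset card_gt_0_iff by metis+
  define c where "c = (\<Sum>w\<in>S. (1 / card S) *\<^sub>R w)"
  have s1: "(\<Sum>w\<in>S. 1 / real (card S)) = 1" using fS S(2) by simp
  have c: "c \<in> convex hull S"
    unfolding convex_hull_finite[OF fS(1)] c_def using s1
    by (auto intro!: exI[of _ "\<lambda>_. 1 / real (card S)"])
  define y where "y n = (1 - inverse (real (Suc n))) *\<^sub>R x + inverse (real (Suc n)) *\<^sub>R c" for n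
  have t: "inverse (real (Suc n)) > 0" "inverse (real (Suc n)) \<le> 1" for n
    by (auto simp: field_simps)
  have y: "y n \<in> convex hull S" for n
    unfolding y_def using convexD[OF convex_convex_hull x c, of "1 - inverse (real (Suc n))"] t[of n]
    by (auto simp del: of_nat_Suc)
  have "lam v (y n) > 0" if "v \<in> W" for v n
  proof -
    have v: "v \<in> S" "v \<in> C" using that W S by auto
    have "lam v c = 1 / card S" unfolding c_def using lam_comb[OF v(2) S(1) s1] v by simp
    then have "inverse (real (Suc n)) * lam v c > 0" using t[of n] fS by (simp del: of_nat_Suc)
    moreover have "(1 - inverse (real (Suc n))) * lam v x \<ge> 0"
      using hull_barycentric(1)[OF S(1) x v(2)] t[of n] by (simp del: of_nat_Suc)
    ultimately show ?thesis unfolding y_def lam_segment[OF v(2)] by linarith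
  qed
  then have "bub W (y n) \<noteq> 0" for n
    unfolding bub_def using prod_pos[of W "\<lambda>v. lam v (y n)"] by force
  then have Fy: "F (y n) = 0" for n using z y by blast
  have "y \<longlonglongrightarrow> (1 - 0) *\<^sub>R x + 0 *\<^sub>R c"
    unfolding y_def by (intro tendsto_intros LIMSEQ_inverse_real_of_nat)
  then have "(\<lambda>n. F (y n)) \<longlonglongrightarrow> F x"
    using continuous_on_tendsto_compose[OF cont, of y x sequentially] y x by simp
  then show ?thesis by (simp add: Fy LIMSEQ_const_iff)
qed

text \<open>Apply \<open>polys_division\<close> with direction \<open>v - w\<close> for a second
  vertex \<open>w\<close> of \<open>S\<close>: subtracting \<open>lam v x\<close> times this
  direction transfers the weight of \<open>v\<close> to \<open>w\<close>, so the shifted point lies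
  on the face opposite \<open>v\<close>, where \<open>r\<close> is zero.\<close>

lemma polys_div_lam:
  assumes r: "r \<in> polys m UNIV" and S: "S \<subseteq> C" "card S \<ge> 2" and v: "v \<in> S"
    and z: "\<And>x. x \<in> convex hull (S - {v}) \<Longrightarrow> r x = 0"
  shows "\<exists>q\<in>polys (m - 1) UNIV. \<forall>x\<in>convex hull S. r x = lam v x * q x"
proof -
  have fS: "finite S" using S finite_vertices finite_subset by blast
  have "S \<noteq> {v}" using S(2) by auto
  then obtain w where w: "w \<in> S" "w \<noteq> v" using v by auto
  obtain q where q: "q \<in> polys (m - 1) UNIV" "\<And>x. r x - r (x - lam v x *\<^sub>R (v - w)) = lam v x * q x"
    using polys_division[OF lam_polys r, of v "v - w"] v S by blast
  have "x - lam v x *\<^sub>R (v - w) \<in> convex hull (S - {v})" if x: "x \<in> convex hull S" for x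
  proof -
    note h = hull_barycentric[OF S(1) x]
    define u where "u a = lam a x + (if a = w then lam v x else 0)" for a
    have "(\<Sum>a\<in>S - {v}. u a) = 1"
      using h(3) fS v w by (simp add: u_def sum.distrib sum.remove[of S v])
    moreover have "(\<Sum>a\<in>S - {v}. u a *\<^sub>R a) = x - lam v x *\<^sub>R (v - w)"
    proof -
      have "(\<Sum>a\<in>S - {v}. u a *\<^sub>R a)
          = (\<Sum>a\<in>S - {v}. lam a x *\<^sub>R a) + (\<Sum>a\<in>S - {v}. if a = w then lam v x *\<^sub>R w else 0)"
        by (subst sum.distrib[symmetric], rule sum.cong) (auto simp: u_def algebra_simps)
      also have "\<dots> = (\<Sum>a\<in>S - {v}. lam a x *\<^sub>R a) + lam v x *\<^sub>R w" using fS w by simp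
      also have "(\<Sum>a\<in>S - {v}. lam a x *\<^sub>R a) = x - lam v x *\<^sub>R v"
        using h(4) fS v by (simp add: sum.remove[of S v] algebra_simps)
      finally show ?thesis by (simp add: algebra_simps)
    qed
    moreover have "\<forall>a\<in>S - {v}. 0 \<le> u a" using h(1) S v w by (auto simp: u_def intro!: add_nonneg_nonneg)
    ultimately show ?thesis using fS by (auto simp: convex_hull_finite intro!: exI[of _ u])
  qed
  then have "\<forall>x\<in>convex hull S. r x = lam v x * q x" using q(2) z by (metis diff_zero)
  then show ?thesis using q(1) by blast
qed

text \<open>The factors are split off one vertex at a time. After division by \<open>bub W\<close>
  the quotient \<open>q\<close> still vanishes opposite the next vertex \<open>v\<close>: on that
  face \<open>bub W x * q x\<close> is zero, and \<open>bub W\<close> is nonzero on a dense subset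
  of it because \<open>v\<close> is not in \<open>W\<close>.\<close>

lemma polys_div_bub:
  assumes p: "p \<in> polys m UNIV" and S: "S \<subseteq> C" "card S \<ge> 2"
    and z: "\<And>v x. v \<in> S \<Longrightarrow> x \<in> convex hull (S - {v}) \<Longrightarrow> p x = 0"
  shows "\<exists>q\<in>polys (m - int (card S)) UNIV. \<forall>x\<in>convex hull S. p x = bub S x * q x"
proof -
  have fS: "finite S" using S finite_vertices finite_subset by blast
  have "\<exists>q\<in>polys (m - int (card W)) UNIV. \<forall>x\<in>convex hull S. p x = bub W x * q x"
    if "W \<subseteq> S" for W
    using finite_subset[OF that fS] that
  proof (induction W rule: finite_induct)
    case empty
    then show ?case using p by (auto simp: bub_def)
  next
    case (insert v W)
    then obtain q where q: "q \<in> polys (m - int (card W)) UNIV"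
      and pq: "\<And>x. x \<in> convex hull S \<Longrightarrow> p x = bub W x * q x" by auto
    have v: "v \<in> S" using insert by auto
    have "q x = 0" if "x \<in> convex hull (S - {v})" for x
    proof (rule bub_dense[OF _ _ _ _ _ that])
      show "W \<subseteq> S - {v}" "S - {v} \<subseteq> C" using insert S by auto
      show "S - {v} \<noteq> {}" using S(2) v by (metis One_nat_def Suc_1 Suc_n_not_le_n card.empty card_Suc_Diff1 fS)
      show "continuous_on (convex hull (S - {v})) q" by (rule continuous_on_polys[OF q])
      show "q x = 0" if "x \<in> convex hull (S - {v})" "bub W x \<noteq> 0" for x
        using z[OF v that(1)] pq[of x] that hull_mono[of "S - {v}" S convex] by auto
    qed
    from polys_div_lam[OF q S v this] obtain q' where
      q': "q' \<in> polys (m - int (card W) - 1) UNIV" "\<And>x. x \<in> convex hull S \<Longrightarrow> q x = lam v x * q' x"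
      by blast
    have "\<forall>x\<in>convex hull S. p x = bub (insert v W) x * q' x"
      using pq q'(2) insert by (simp add: bub_def)
    moreover have "m - int (card W) - 1 = m - int (card (insert v W))" using insert by simp
    ultimately show ?case using q'(1) by metis
  qed
  then show ?thesis by blast
qed

text \<open>Entrywise quotients are chosen independently and need not assemble to a matrix in
  \<open>X\<close>. Composing with a projection onto \<open>X\<close> repairs this and preserves the
  identity, since \<open>F\<close> takes values in \<open>X\<close> on the hull.\<close>

lemma polys_tensor_div_bub:
  assumes F: "F \<in> polys_tensor m UNIV UNIV" and X: "subspace X" and S: "S \<subseteq> C" "card S \<ge> 2"
    and FX: "\<And>x. x \<in> convex hull S \<Longrightarrow> F x \<in> X"
    and z: "\<And>v x. v \<in> S \<Longrightarrow> x \<in> convex hull (S - {v}) \<Longrightarrow> F x = 0"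
  shows "\<exists>G\<in>polys_tensor (m - int (card S)) UNIV X. \<forall>x\<in>convex hull S. F x = bub S x *\<^sub>R G x"
proof -
  let ?n = "m - int (card S)"
  have "\<exists>q\<in>polys ?n UNIV. \<forall>x\<in>convex hull S. F x \<bullet> A = bub S x * q x" for A
    using z by (intro polys_div_bub polys_tensor_UNIV_D(1)[OF subspace_UNIV F] S) simp
  then obtain q where q: "\<And>A. q A \<in> polys ?n UNIV"
    "\<And>A x. x \<in> convex hull S \<Longrightarrow> F x \<bullet> A = bub S x * q A x" by metis
  obtain g where g: "linear g" "\<And>x. g x \<in> X" "\<And>x. x \<in> X \<Longrightarrow> g x = x"
    using subspace_projection[OF X] by blast
  define G where "G x = (\<Sum>A\<in>Basis. q A x *\<^sub>R g A)" for x
  have "G \<in> polys_tensor ?n UNIV X"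
  proof (rule polys_tensor_UNIV_I[OF X])
    fix A :: "real^3^3"
    have "(\<lambda>x. \<Sum>B\<in>Basis. (g B \<bullet> A) * q B x) \<in> polys ?n UNIV"
      by (intro polys_sum polys_cmult q)
    then show "(\<lambda>x. G x \<bullet> A) \<in> polys ?n UNIV"
      by (simp add: G_def inner_sum_left mult.commute)
  next
    show "G x \<in> X" for x unfolding G_def by (intro subspace_sum subspace_scale X g)
  qed
  moreover have "F x = bub S x *\<^sub>R G x" if x: "x \<in> convex hull S" for x
  proof -
    have "F x = g (\<Sum>A\<in>Basis. (F x \<bullet> A) *\<^sub>R A)"
      using g(3)[OF FX[OF x]] by (simp add: euclidean_representation)
    also have "\<dots> = (\<Sum>A\<in>Basis. (F x \<bullet> A) *\<^sub>R g A)"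
      by (simp only: linear_sum[OF g(1)] linear_scale[OF g(1)])
    also have "\<dots> = bub S x *\<^sub>R G x"
      by (simp add: G_def q(2)[OF x] scaleR_sum_right)
    finally show ?thesis .
  qed
  ultimately show ?thesis by blast
qed

end

text \<open>Affine independence makes the differences from a fixed vertex \<open>a\<close> linearly
  independent, so a linear map can be prescribed on them, and a constant then fixes the value at
  \<open>a\<close>. Prescribing 0 and 1 on \<open>C\<close> gives the coordinates.\<close>

lemma ex_barycentric:
  fixes C :: "(real^3) set"
  assumes "\<not> affine_dependent C"
  shows "\<exists>lam. barycentric C lam"
proof -
  have fin: "finite C" using assms aff_independent_finite by blast
  have ex: "\<exists>g c. linear g \<and> (\<forall>w\<in>C. g w + c = h w)" for h :: "real^3 \<Rightarrow> real"
  proof (cases "C = {}")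
    case False
    then obtain a where a: "a \<in> C" by auto
    define B where "B = (\<lambda>x. x - a) ` (C - {a})"
    have "B = (\<lambda>x. - a + x) ` (C - {a})" by (auto simp: B_def)
    then have "independent B" using assms affine_dependent_iff_dependent2[OF a] by simp
    then obtain g where g: "linear g" "\<And>b. b \<in> B \<Longrightarrow> g b = h (b + a) - h a"
      using linear_independent_extend[of B "\<lambda>b. h (b + a) - h a"] by blast
    have "g w + (h a - g a) = h w" if "w \<in> C" for w
    proof (cases "w = a")
      case False
      then show ?thesis using g(2)[of "w - a"] that by (auto simp: B_def linear_diff[OF g(1)])
    qed simp
    then show ?thesis using g(1) by blast
  qed (use linear_zero in blast)
  have "\<forall>v. \<exists>g c. linear g \<and> (\<forall>w\<in>C. g w + c = (if v = w then 1 else (0::real)))"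
    using ex by simp
  then obtain g c where gc: "\<And>v. linear (g v)" "\<And>v w. w \<in> C \<Longrightarrow> g v w + c v = (if v = w then 1 else (0::real))"
    by metis
  have "barycentric C (\<lambda>v x. g v x + c v)"
    by unfold_locales (use fin gc in auto)
  then show ?thesis by blast
qed

section \<open>Integrals over faces and tangential projections\<close>

text \<open>Collects what is used below about the integrals over an edge, a face and
  \<open>T\<close>, so that the weighted norm argument is made once. Linearity is limited to
  continuous functions, which are integrable on a compact \<open>s\<close>.\<close>

definition pos_functional :: "(real^3) set \<Rightarrow> ((real^3 \<Rightarrow> real) \<Rightarrow> real) \<Rightarrow> bool" where
  "pos_functional s L \<longleftrightarrow>
    (\<forall>f g. (\<forall>x\<in>s. f x = g x) \<longrightarrow> L f = L g) \<and>
    (\<forall>f g. continuous_on s f \<longrightarrow> continuous_on s g \<longrightarrow> L (\<lambda>x. f x + g x) = L f + L g) \<and>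
    (\<forall>c f. continuous_on s f \<longrightarrow> L (\<lambda>x. c * f x) = c * L f) \<and>
    (\<forall>f. continuous_on s f \<longrightarrow> (\<forall>x\<in>s. 0 \<le> f x) \<longrightarrow> L f = 0 \<longrightarrow> (\<forall>x\<in>s. f x = 0))"

lemma pos_functionalD:
  assumes "pos_functional s L"
  shows "(\<And>x. x \<in> s \<Longrightarrow> f x = g x) \<Longrightarrow> L f = L g"
    "continuous_on s f \<Longrightarrow> continuous_on s g \<Longrightarrow> L (\<lambda>x. f x + g x) = L f + L g"
    "continuous_on s f \<Longrightarrow> L (\<lambda>x. c * f x) = c * L f"
    "continuous_on s f \<Longrightarrow> (\<And>x. x \<in> s \<Longrightarrow> 0 \<le> f x) \<Longrightarrow> L f = 0 \<Longrightarrow> x \<in> s \<Longrightarrow> f x = 0"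
  using assms unfolding pos_functional_def by blast+

lemma pos_functional_0:
  assumes "pos_functional s L" "\<And>x. x \<in> s \<Longrightarrow> f x = 0"
  shows "L f = 0"
  using pos_functionalD(1)[OF assms(1), of f "\<lambda>x. 0 * 0"] pos_functionalD(3)[OF assms(1), of "\<lambda>_. 0" 0]
    assms(2) by simp

lemma pos_functional_sum:
  assumes L: "pos_functional s L" and "\<And>i. i \<in> I \<Longrightarrow> continuous_on s (f i)"
  shows "L (\<lambda>x. \<Sum>i\<in>I. c i * f i x) = (\<Sum>i\<in>I. c i * L (f i))"
  using assms(2)
proof (induction I rule: infinite_finite_induct)
  case (insert i I)
  have "L (\<lambda>x. c i * f i x + (\<Sum>i\<in>I. c i * f i x)) = L (\<lambda>x. c i * f i x) + L (\<lambda>x. \<Sum>i\<in>I. c i * f i x)"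
    using insert by (intro pos_functionalD(2)[OF L] continuous_intros) auto
  then show ?case using insert pos_functionalD(3)[OF L, of "f i" "c i"] by simp
qed (simp_all add: pos_functional_0[OF L])

text \<open>A flat \<open>s\<close> has empty interior in space, so density is obtained in the
  chart: the preimage of the relative interior is open, a convex set lies in the closure of its
  relative interior, and the isometry carries approximation back.\<close>

lemma flat_chart_dense:
  fixes \<phi> :: "'d::euclidean_space \<Rightarrow> real^3"
  assumes "flat_chart s \<phi>" "convex s" "t \<in> \<phi> -` s"
  shows "t \<in> closure (interior (\<phi> -` s))"
proof -
  have dist: "dist (\<phi> x) (\<phi> y) = dist x y" for x y using assms(1) by (simp add: flat_chart_def)
  have rng: "range \<phi> = affine hull s" using assms(1) by (simp add: flat_chart_def)
  have cont: "continuous_on UNIV \<phi>"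
    unfolding continuous_on_iff using dist by auto
  have "openin (top_of_set UNIV) (UNIV \<inter> \<phi> -` rel_interior s)"
    by (rule continuous_openin_preimage[OF cont, of "affine hull s"])
       (use rng in \<open>auto simp: rel_interior_eq[symmetric] openin_rel_interior\<close>)
  then have "open (\<phi> -` rel_interior s)" by simp
  then have sub: "\<phi> -` rel_interior s \<subseteq> interior (\<phi> -` s)"
    using rel_interior_subset[of s] by (intro interior_maximal) auto
  have "\<phi> t \<in> closure (rel_interior s)"
    using assms closure_subset convex_closure_rel_interior by auto
  then show ?thesis unfolding closure_approachable
  proof safe
    fix e :: real assume "\<forall>e>0. \<exists>y\<in>rel_interior s. dist y (\<phi> t) < e" "e > 0"
    then obtain y where y: "y \<in> rel_interior s" "dist y (\<phi> t) < e" by blast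
    then have "y \<in> range \<phi>" using rng rel_interior_subset hull_subset[of s affine] by blast
    then obtain u where "y = \<phi> u" by auto
    then show "\<exists>y\<in>interior (\<phi> -` s). dist y t < e" using y sub dist by auto
  qed
qed

text \<open>The point is definiteness. A nonnegative continuous function with zero integral vanishes
  almost everywhere; inside the interior of the chart domain its nonzero set is open and null, hence
  empty; \<open>flat_chart_dense\<close> and continuity reach the remaining points.\<close>

lemma pos_functional_chart:
  fixes \<phi> :: "'d::euclidean_space \<Rightarrow> real^3"
  assumes ch: "flat_chart s \<phi>" and s: "convex s" "compact s"
  shows "pos_functional s (\<lambda>g. LINT t : \<phi> -` s | lborel. g (\<phi> t))"
proof -
  define K where "K = \<phi> -` s"
  have dist: "dist (\<phi> x) (\<phi> y) = dist x y" for x y using ch by (simp add: flat_chart_def)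
  have rng: "range \<phi> = affine hull s" using ch by (simp add: flat_chart_def)
  have cont: "continuous_on A \<phi>" for A
    unfolding continuous_on_iff using dist by auto
  have "closed K" unfolding K_def
    by (rule closed_vimage[OF compact_imp_closed[OF s(2)] cont])
  moreover have "bounded K"
  proof -
    obtain e where e: "\<And>x y. x \<in> s \<Longrightarrow> y \<in> s \<Longrightarrow> dist x y \<le> e"
      using iffD1[OF bounded_two_points compact_imp_bounded[OF s(2)]] by metis
    show ?thesis unfolding bounded_two_points K_def
      by (intro exI[of _ e] ballI) (simp add: e flip: dist)
  qed
  ultimately have K: "compact K" by (simp add: compact_eq_bounded_closed)
  have ck: "continuous_on K (\<lambda>t. g (\<phi> t))" if "continuous_on s g" for g :: "real^3 \<Rightarrow> real"
    using that by (intro continuous_on_compose2[OF that cont]) (auto simp: K_def)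
  have int: "set_integrable lborel K (\<lambda>t. g (\<phi> t))" if "continuous_on s g" for g :: "real^3 \<Rightarrow> real"
    unfolding set_integrable_def by (rule borel_integrable_compact[OF K ck[OF that]])
  show ?thesis unfolding pos_functional_def K_def[symmetric]
  proof (intro conjI allI impI ballI)
    fix f g :: "real^3 \<Rightarrow> real"
    assume "\<forall>x\<in>s. f x = g x"
    then show "(LINT t:K|lborel. f (\<phi> t)) = (LINT t:K|lborel. g (\<phi> t))"
      unfolding set_lebesgue_integral_def
      by (intro Bochner_Integration.integral_cong) (auto simp: K_def indicator_def)
  next
    fix f g :: "real^3 \<Rightarrow> real"
    assume "continuous_on s f" "continuous_on s g"
    then show "(LINT t:K|lborel. f (\<phi> t) + g (\<phi> t)) = (LINT t:K|lborel. f (\<phi> t)) + (LINT t:K|lborel. g (\<phi> t))"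
      using int by (intro set_integral_add) auto
  next
    fix f :: "real^3 \<Rightarrow> real" and c
    show "(LINT t:K|lborel. c * f (\<phi> t)) = c * (LINT t:K|lborel. f (\<phi> t))"
      by simp
  next
    fix f :: "real^3 \<Rightarrow> real" and x
    assume f: "continuous_on s f" "\<forall>x\<in>s. 0 \<le> f x" "(LINT t:K|lborel. f (\<phi> t)) = 0" and x: "x \<in> s"
    have "AE t in lborel. indicator K t *\<^sub>R f (\<phi> t) = 0"
      using f(3) int[OF f(1)] f(2) unfolding set_lebesgue_integral_def set_integrable_def
      by (subst (asm) integral_nonneg_eq_0_iff_AE) (auto simp: K_def indicator_def)
    then have ae: "AE t in lborel. t \<notin> {t \<in> interior K. f (\<phi> t) \<noteq> 0}"
      by eventually_elim (use interior_subset in \<open>auto simp: indicator_def\<close>)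
    have "continuous_on (interior K) (\<lambda>t. f (\<phi> t))"
      using ck[OF f(1)] continuous_on_subset interior_subset by blast
    then have "openin (top_of_set (interior K)) (interior K \<inter> (\<lambda>t. f (\<phi> t)) -` (- {0}))"
      by (rule continuous_openin_preimage_gen) auto
    then have op: "open {t \<in> interior K. f (\<phi> t) \<noteq> 0}"
      by (auto simp: openin_open_eq vimage_def Int_def)
    have "{t \<in> interior K. f (\<phi> t) \<noteq> 0} \<in> null_sets lborel"
      using ae op by (intro iffD2[OF AE_iff_null_sets]) auto
    then have "negligible {t \<in> interior K. f (\<phi> t) \<noteq> 0}"
      unfolding negligible_iff_null_sets by (rule null_sets_completionI)
    then have z: "f (\<phi> t) = 0" if "t \<in> interior K" for t
      using open_not_negligible[OF op] that by blast
    have "x \<in> range \<phi>" using x rng hull_subset[of s affine] by blast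
    then obtain t where t: "x = \<phi> t" by auto
    then have tK: "t \<in> K" "t \<in> closure (interior K)"
      using x flat_chart_dense[OF ch s(1), of t] by (auto simp: K_def)
    then obtain u where u: "\<And>n. u n \<in> interior K" "u \<longlonglongrightarrow> t" by (auto simp: closure_sequential)
    then have "(\<lambda>n. f (\<phi> (u n))) \<longlonglongrightarrow> f (\<phi> t)"
      using interior_subset[of K]
      by (intro continuous_on_tendsto_compose[OF ck[OF f(1)] u(2) tK(1)]) (use u(1) in \<open>blast intro: always_eventually\<close>)
    then show "f x = 0" by (simp add: z[OF u(1)] t LIMSEQ_const_iff)
  qed
qed

lemma pos_functional_edge:
  assumes "aff_dim s = 1" "convex s" "compact s"
  shows "pos_functional s (edge_integral s)"
proof -
  have "flat_chart s (SOME \<phi> :: real \<Rightarrow> real^3. flat_chart s \<phi>)"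
    by (rule someI_ex[OF ex_flat_chart]) (simp add: assms)
  from pos_functional_chart[OF this assms(2,3)] show ?thesis
    by (simp add: edge_integral_def[abs_def] Let_def)
qed

lemma pos_functional_face:
  assumes "aff_dim s = 2" "convex s" "compact s"
  shows "pos_functional s (face_integral s)"
proof -
  have "flat_chart s (SOME \<phi> :: real^2 \<Rightarrow> real^3. flat_chart s \<phi>)"
    by (rule someI_ex[OF ex_flat_chart]) (simp add: assms)
  from pos_functional_chart[OF this assms(2,3)] show ?thesis
    by (simp add: face_integral_def[abs_def] Let_def)
qed

lemma pos_functional_volume:
  assumes "aff_dim s = 3" "convex s" "compact s"
  shows "pos_functional s (\<lambda>g. LINT x : s | lborel. g x)"
proof -
  have "affine hull s = UNIV" using assms(1) aff_dim_eq_full[of s] by simp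
  then have "flat_chart s (\<lambda>x. x)" by (simp add: flat_chart_def)
  from pos_functional_chart[OF this assms(2,3)] show ?thesis by simp
qed

section \<open>Linear images of matrix fields\<close>

lemma polys_tensor_linear:
  fixes h :: "real^3^3 \<Rightarrow> real^3^3"
  assumes h: "linear h" and F: "F \<in> polys_tensor m UNIV X" and Y: "subspace Y" "\<And>x. h (F x) \<in> Y"
  shows "(\<lambda>x. h (F x)) \<in> polys_tensor m UNIV Y"
proof (rule polys_tensor_UNIV_I[OF Y(1) _ Y(2)])
  fix A :: "real^3^3"
  have F': "F \<in> polys_tensor m UNIV UNIV" using F polys_tensor_mono[of m m X UNIV] by auto
  have "h (F x) = (\<Sum>B\<in>Basis. (F x \<bullet> B) *\<^sub>R h B)" for x
  proof -
    have "h (F x) = h (\<Sum>B\<in>Basis. (F x \<bullet> B) *\<^sub>R B)" by (simp add: euclidean_representation)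
    then show ?thesis by (simp only: linear_sum[OF h] linear_scale[OF h])
  qed
  then have "(\<lambda>x. h (F x) \<bullet> A) = (\<lambda>x. \<Sum>B\<in>Basis. (h B \<bullet> A) * (F x \<bullet> B))"
    by (simp add: inner_sum_left mult.commute)
  also have "\<dots> \<in> polys m UNIV"
    by (intro polys_sum polys_cmult polys_tensor_UNIV_D(1)[OF subspace_UNIV F'])
  finally show "(\<lambda>x. h (F x) \<bullet> A) \<in> polys m UNIV" .
qed

lemma trace_eq_inner: "trace A = A \<bullet> mat 1" for A :: "real^3^3"
  by (simp add: trace_def inner_vec_def mat_def if_distrib cong: if_cong)

lemma polys_trace: "F \<in> polys_tensor m UNIV X \<Longrightarrow> (\<lambda>x. trace (F x)) \<in> polys m UNIV"
  unfolding trace_eq_inner using polys_tensor_mono[of m m X UNIV]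
  by (intro polys_tensor_UNIV_D(1)[OF subspace_UNIV]) auto

section \<open>Rank-one matrices and the tangential part of a symmetric matrix\<close>

definition outer :: "real^3 \<Rightarrow> real^3 \<Rightarrow> real^3^3" where
  "outer u v = (\<chi> i j. u $ i * v $ j)"

lemma mult_outer: "A ** outer u v = outer (A *v u) v"
  by (simp add: outer_def vec_eq_iff matrix_matrix_mult_def matrix_vector_mult_def sum_distrib_right mult.assoc)

lemma outer_mult: "outer u v ** A = outer u (transpose A *v v)"
  by (simp add: outer_def vec_eq_iff matrix_matrix_mult_def matrix_vector_mult_def transpose_def
      sum_distrib_left mult_ac)

lemma linear_conj: "linear (\<lambda>A. P ** A ** Q)" for P Q :: "real^3^3"
  by (intro linearI)
     (simp_all add: vec_eq_iff matrix_matrix_mult_def sum.distrib sum_distrib_left sum_distrib_right algebra_simps)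

lemma sym_tangent_alt: "sym_tangent f = span {outer u v + outer v u | u v. u \<in> tangent f \<and> v \<in> tangent f}"
  unfolding sym_tangent_def
  by (intro arg_cong[of _ _ span]) (simp add: outer_def plus_vec_def)

lemma subspace_sym3: "subspace sym3"
  by (auto simp: subspace_def sym3_def transpose_def vec_eq_iff)

lemma subspace_sym_tangent: "subspace (sym_tangent f)"
  unfolding sym_tangent_def by (rule subspace_span)

lemma sym_tangent_subset_sym3: "sym_tangent f \<subseteq> sym3"
  unfolding sym_tangent_def
  by (intro span_minimal subspace_sym3) (auto simp: sym3_def transpose_def vec_eq_iff)

lemma subspace_tangent: "subspace (tangent f)"
  unfolding tangent_def by (rule subspace_span)

text \<open>The matrix is given by a definite description, so existence and uniqueness are both
  owed. An orthonormal basis of the tangent space supplies it; two candidates differ, at each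
  vector, by a tangent vector orthogonal to itself.\<close>

lemma tangent_proj_spec:
  "tangent_proj f *v x \<in> tangent f \<and> (\<forall>y\<in>tangent f. orthogonal (x - tangent_proj f *v x) y)"
proof -
  let ?R = "\<lambda>P :: real^3^3. \<forall>x. P *v x \<in> tangent f \<and> (\<forall>y\<in>tangent f. orthogonal (x - P *v x) y)"
  obtain B where B: "B \<subseteq> tangent f" "pairwise orthogonal B" "\<And>x. x \<in> B \<Longrightarrow> norm x = 1"
      "independent B" "span B = tangent f"
    using orthonormal_basis_subspace[OF subspace_tangent[of f]] by metis
  have fin: "finite B" using B(4) by (rule independent_imp_finite)
  define h where "h x = (\<Sum>b\<in>B. (x \<bullet> b) *\<^sub>R b)" for x
  have "linear h" by (intro linearI)
    (simp_all add: h_def inner_add_left scaleR_add_left sum.distrib scaleR_sum_right)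
  then have h: "matrix h *v x = h x" for x by (simp add: matrix_works)
  have "?R (matrix h)" unfolding h
  proof (intro allI conjI ballI)
    fix x
    show "h x \<in> tangent f" unfolding h_def
      by (intro subspace_sum subspace_tangent subspace_scale) (use B in auto)
    fix y assume "y \<in> tangent f"
    then have "y \<in> span B" using B by simp
    moreover have "orthogonal (x - h x) c" if "c \<in> B" for c
    proof -
      have "h x \<bullet> c = (\<Sum>b\<in>B. if b = c then x \<bullet> c else 0)"
        unfolding h_def inner_sum_left using B(2,3) that
        by (intro sum.cong) (auto simp: pairwise_def orthogonal_def dot_square_norm)
      then show ?thesis using that fin by (simp add: orthogonal_def inner_diff_left)
    qed
    ultimately show "orthogonal (x - h x) y" by (rule orthogonal_to_span)
  qed
  moreover have "P = Q" if P: "?R P" and Q: "?R Q" for P Q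
  proof -
    have "P *v x = Q *v x" for x
    proof -
      have d: "P *v x - Q *v x \<in> tangent f" using P Q by (intro subspace_diff subspace_tangent) auto
      then have "(x - Q *v x) \<bullet> (P *v x - Q *v x) = 0" "(x - P *v x) \<bullet> (P *v x - Q *v x) = 0"
        using P Q by (auto simp: orthogonal_def)
      then have "(P *v x - Q *v x) \<bullet> (P *v x - Q *v x) = 0" by (simp add: inner_diff_left)
      then show ?thesis by simp
    qed
    then show ?thesis by (simp add: matrix_eq)
  qed
  ultimately have "\<exists>!P. ?R P" by blast
  from theI'[OF this] show ?thesis unfolding tangent_proj_def by blast
qed

lemma tangent_proj_id:
  assumes "y \<in> tangent f" shows "tangent_proj f *v y = y"
proof -
  have "y - tangent_proj f *v y \<in> tangent f"
    using assms tangent_proj_spec by (intro subspace_diff subspace_tangent) auto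
  then have "(y - tangent_proj f *v y) \<bullet> (y - tangent_proj f *v y) = 0"
    using tangent_proj_spec[of f y] by (auto simp: orthogonal_def)
  then show ?thesis by simp
qed

text \<open>The inner product of \<open>?P *v x\<close> with \<open>y\<close> equals that of
  \<open>?P *v x\<close> with \<open>?P *v y\<close>, which is symmetric in \<open>x\<close> and
  \<open>y\<close>. Self-adjointness lets conjugation of \<open>outer u v\<close> project both
  vectors.\<close>

lemma transpose_tangent_proj: "transpose (tangent_proj f) = tangent_proj f"
proof -
  let ?P = "tangent_proj f"
  have a: "(?P *v x) \<bullet> y = (?P *v x) \<bullet> (?P *v y)" for x y
  proof -
    have "(y - ?P *v y) \<bullet> (?P *v x) = 0"
      using tangent_proj_spec[of f y] tangent_proj_spec[of f x] by (auto simp: orthogonal_def)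
    then have "(?P *v x) \<bullet> (y - ?P *v y) = 0" by (simp only: inner_commute)
    then show ?thesis by (simp add: inner_diff_right)
  qed
  have "x \<bullet> (transpose ?P *v y) = x \<bullet> (?P *v y)" for x y
  proof -
    have "x \<bullet> (transpose ?P *v y) = (y v* ?P) \<bullet> x" by (simp add: inner_commute)
    also have "\<dots> = (?P *v x) \<bullet> y" unfolding dot_lmul_matrix by (rule inner_commute)
    also have "\<dots> = x \<bullet> (?P *v y)" using a[of x y] a[of y x] by (simp add: inner_commute)
    finally show ?thesis .
  qed
  then have "transpose ?P *v y = ?P *v y" for y by (metis vector_eq_rdot inner_commute)
  then show ?thesis by (simp add: matrix_eq)
qed

lemma tangent_proj_conj_outer:
  "tangent_proj f ** outer u v ** tangent_proj f = outer (tangent_proj f *v u) (tangent_proj f *v v)"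
  by (simp add: mult_outer outer_mult transpose_tangent_proj)

lemma tangent_proj_conj_id:
  assumes "A \<in> sym_tangent f"
  shows "tangent_proj f ** A ** tangent_proj f = A"
  using assms unfolding sym_tangent_alt
proof (rule linear_eq_on[OF linear_conj linear_ident])
  show "tangent_proj f ** A ** tangent_proj f = A"
    if "A \<in> {outer u v + outer v u |u v. u \<in> tangent f \<and> v \<in> tangent f}" for A
    using that linear_add[OF linear_conj[of "tangent_proj f" "tangent_proj f"]]
    by (auto simp: tangent_proj_conj_outer tangent_proj_id)
qed

text \<open>Brings a symmetric matrix into the shape of the generators of
  \<open>sym_tangent\<close>; the factor 1/2 is that of A = (A + A^T) / 2.\<close>

lemma sym3_expansion:
  assumes "A \<in> sym3"
  shows "A = (\<Sum>i\<in>UNIV. \<Sum>j\<in>UNIV. (A $ i $ j / 2) *\<^sub>R (outer (axis i 1) (axis j 1) + outer (axis j 1) (axis i 1)))"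
proof -
  have "A $ i $ j = A $ j $ i" for i j
    using assms by (auto simp: sym3_def transpose_def vec_eq_iff)
  then have "A $ 1 $ 2 = A $ 2 $ 1" "A $ 1 $ 3 = A $ 3 $ 1" "A $ 2 $ 3 = A $ 3 $ 2" by blast+
  then show ?thesis
    by (simp add: vec_eq_iff forall_3 sum_3 outer_def axis_def)
qed

lemma tangent_proj_conj_sym3:
  assumes "A \<in> sym3"
  shows "tangent_proj f ** A ** tangent_proj f \<in> sym_tangent f"
proof -
  let ?h = "\<lambda>A. tangent_proj f ** A ** tangent_proj f"
  let ?e = "\<lambda>i::3. tangent_proj f *v axis i 1"
  have "?h A = (\<Sum>i\<in>UNIV. \<Sum>j\<in>UNIV. (A $ i $ j / 2) *\<^sub>R (outer (?e i) (?e j) + outer (?e j) (?e i)))"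
    by (subst sym3_expansion[OF assms])
       (simp only: linear_sum[OF linear_conj] linear_scale[OF linear_conj] linear_add[OF linear_conj] tangent_proj_conj_outer)
  also have "\<dots> \<in> sym_tangent f"
  proof (intro subspace_sum subspace_scale subspace_sym_tangent)
    show "outer (?e i) (?e j) + outer (?e j) (?e i) \<in> sym_tangent f" for i j
      unfolding sym_tangent_alt by (rule span_base) (use tangent_proj_spec in blast)
  qed
  finally show ?thesis .
qed

text \<open>The witness is n n^T / |n|^2 with \<open>n\<close> normal to the face: the projection
  kills \<open>n\<close>, and the trace of n n^T is |n|^2. It separates the \<open>Face\<close>
  forms from the \<open>FaceTrace\<close> forms.\<close>

lemma ex_normal_matrix:
  assumes "tangent f \<noteq> UNIV"
  shows "\<exists>N\<in>sym3. tangent_proj f ** N ** tangent_proj f = 0 \<and> trace N = 1"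
proof -
  have "span (tangent f) \<subset> UNIV"
    unfolding iffD2[OF span_eq_iff subspace_tangent] using assms by auto
  then obtain n where n: "n \<noteq> 0" "\<And>y. y \<in> span (tangent f) \<Longrightarrow> orthogonal n y"
    using orthogonal_to_subspace_exists_gen[of "tangent f" UNIV] by auto
  have t: "tangent_proj f *v n \<in> tangent f" using tangent_proj_spec by blast
  \<comment> \<open>The residual of the projection is orthogonal to the tangent space, and so is
    \<open>n\<close>; the difference of the two equations says that the projection of
    \<open>n\<close> has norm zero.\<close>
  have "(n - tangent_proj f *v n) \<bullet> (tangent_proj f *v n) = 0" "n \<bullet> (tangent_proj f *v n) = 0"
    using tangent_proj_spec[of f n] t n(2) span_base by (auto simp: orthogonal_def)
  then have z: "tangent_proj f *v n = 0" by (simp add: inner_diff_left)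
  define N where "N = (1 / (n \<bullet> n)) *\<^sub>R outer n n"
  have "N \<in> sym3" by (simp add: N_def sym3_def transpose_def outer_def vec_eq_iff mult.commute)
  moreover have "tangent_proj f ** N ** tangent_proj f = 0"
  proof -
    have "tangent_proj f ** N ** tangent_proj f = (1 / (n \<bullet> n)) *\<^sub>R outer 0 0"
      unfolding N_def linear_scale[OF linear_conj] tangent_proj_conj_outer z ..
    then show ?thesis by (simp add: outer_def vec_eq_iff)
  qed
  moreover have "trace N = 1"
  proof -
    have "trace (outer n n) = n \<bullet> n" by (simp add: trace_def outer_def inner_vec_def)
    then have "trace N = (1 / (n \<bullet> n)) * (n \<bullet> n)" by (simp add: N_def trace_eq_inner)
    then show ?thesis using n(1) by simp
  qed
  ultimately show ?thesis by blast
qed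

section \<open>Bases of the dual space\<close>

text \<open>Linearity is relative to \<open>V\<close>: the forms are functions on all fields, and
  the integrals are additive only for integrable integrands.\<close>

definition linear_form_on :: "'v::real_vector set \<Rightarrow> ('v \<Rightarrow> real) \<Rightarrow> bool" where
  "linear_form_on V l \<longleftrightarrow> (\<forall>x\<in>V. \<forall>y\<in>V. l (x + y) = l x + l y) \<and> (\<forall>c. \<forall>x\<in>V. l (c *\<^sub>R x) = c * l x)"

lemma linear_form_onD:
  assumes "linear_form_on V l"
  shows "x \<in> V \<Longrightarrow> y \<in> V \<Longrightarrow> l (x + y) = l x + l y" "x \<in> V \<Longrightarrow> l (c *\<^sub>R x) = c * l x"
  using assms by (auto simp: linear_form_on_def)

lemma linear_form_on_subset: "linear_form_on V l \<Longrightarrow> W \<subseteq> V \<Longrightarrow> linear_form_on W l"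
  by (auto simp: linear_form_on_def subset_iff)

text \<open>Induction on the number of forms. On the kernel \<open>W\<close> of \<open>f j\<close>
  the remaining forms suffice; a vector \<open>z\<close> with \<open>f j z = 1\<close> splits every
  \<open>x\<close> into a part in \<open>W\<close> and a multiple of \<open>z\<close>.\<close>

lemma linear_form_combination:
  assumes "finite I" "subspace V" "linear_form_on V l" "\<And>i. i \<in> I \<Longrightarrow> linear_form_on V (f i)"
    and "\<And>x. x \<in> V \<Longrightarrow> (\<And>i. i \<in> I \<Longrightarrow> f i x = 0) \<Longrightarrow> l x = 0"
  shows "\<exists>c. \<forall>x\<in>V. l x = (\<Sum>i\<in>I. c i * f i x)"
  using assms
proof (induction I arbitrary: V rule: finite_induct)
  case empty
  then show ?case by simp
next
  case (insert j I)
  note V = \<open>subspace V\<close> and l = \<open>linear_form_on V l\<close>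
  have fj: "linear_form_on V (f j)" using insert.prems by auto
  define W where "W = {x \<in> V. f j x = 0}"
  have fj0: "f j 0 = 0" using linear_form_onD(2)[OF fj subspace_0[OF V], of 0] by simp
  have "subspace W" using V fj fj0 unfolding W_def subspace_def linear_form_on_def by auto
  moreover have "W \<subseteq> V" by (auto simp: W_def)
  ultimately have "\<exists>c. \<forall>x\<in>W. l x = (\<Sum>i\<in>I. c i * f i x)"
    using insert.prems by (intro insert.IH) (auto simp: W_def intro: linear_form_on_subset)
  then obtain c where c: "\<And>x. x \<in> W \<Longrightarrow> l x = (\<Sum>i\<in>I. c i * f i x)" by blast
  show ?case
  proof (cases "\<forall>x\<in>V. f j x = 0")
    case True
    then show ?thesis using c insert.hyps by (intro exI[of _ c]) (auto simp: W_def)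
  next
    case False
    then obtain z' where z': "z' \<in> V" "f j z' \<noteq> 0" by blast
    define z where "z = (1 / f j z') *\<^sub>R z'"
    have z: "z \<in> V" "f j z = 1"
      using z' V linear_form_onD(2)[OF fj z'(1)] by (auto simp: z_def subspace_scale)
    \<comment> \<open>The coefficient of \<open>f j\<close> is forced by evaluating both sides at
      \<open>z\<close>; the others are kept.\<close>
    define c' where "c' i = (if i = j then l z - (\<Sum>i\<in>I. c i * f i z) else c i)" for i
    have "l x = (\<Sum>i\<in>insert j I. c' i * f i x)" if x: "x \<in> V" for x
    proof -
      have m: "(- f j x) *\<^sub>R z \<in> V" using z V by (intro subspace_scale)
      have e: "g (x + (- f j x) *\<^sub>R z) = g x - f j x * g z" if "linear_form_on V g" for g
        using linear_form_onD(1)[OF that x m] linear_form_onD(2)[OF that z(1), of "- f j x"] by simp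
      have "x + (- f j x) *\<^sub>R z \<in> W"
        using subspace_add[OF V x m] e[OF fj] z unfolding W_def by simp
      from c[OF this] have "l x - f j x * l z = (\<Sum>i\<in>I. c i * (f i x - f j x * f i z))"
        using e[OF l] e insert.prems by (simp cong: sum.cong)
      also have "\<dots> = (\<Sum>i\<in>I. c i * f i x) - f j x * (\<Sum>i\<in>I. c i * f i z)"
        by (simp add: algebra_simps sum_subtractf sum_distrib_left)
      finally have "l x = (l z - (\<Sum>i\<in>I. c i * f i z)) * f j x + (\<Sum>i\<in>I. c i * f i x)"
        by (simp add: algebra_simps)
      also have "(\<Sum>i\<in>I. c i * f i x) = (\<Sum>i\<in>I. c' i * f i x)"
        using insert.hyps by (intro sum.cong) (auto simp: c'_def)
      finally show ?thesis using insert.hyps by (simp add: c'_def)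
    qed
    then show ?thesis by blast
  qed
qed

lemma form_on_apply: "x \<in> V \<Longrightarrow> form_on V l x = l x"
  by (simp add: form_on_def)

lemma subspace_dual_space: "subspace (dual_space V)"
  unfolding subspace_def dual_space_def by (auto simp: algebra_simps)

text \<open>\<open>ker\<close> makes the forms span the dual, through
  \<open>linear_form_combination\<close>. \<open>ind\<close> speaks of the indexed family rather
  than of the set of forms, so it yields injectivity as well as independence.\<close>

lemma unisolventI:
  assumes V: "subspace V" and I: "finite I"
    and lin: "\<And>i. i \<in> I \<Longrightarrow> linear_form_on V (l i)"
    and ker: "\<And>x. x \<in> V \<Longrightarrow> (\<And>i. i \<in> I \<Longrightarrow> l i x = 0) \<Longrightarrow> x = 0"
    and ind: "\<And>c i. (\<And>x. x \<in> V \<Longrightarrow> (\<Sum>i\<in>I. c i * l i x) = 0) \<Longrightarrow> i \<in> I \<Longrightarrow> c i = 0"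
  shows "unisolvent I l V"
proof -
  let ?F = "\<lambda>i. form_on V (l i)"
  have inj: "inj_on ?F I"
  proof (rule inj_onI, rule ccontr)
    fix i j assume ij: "i \<in> I" "j \<in> I" "?F i = ?F j" "i \<noteq> j"
    \<comment> \<open>Two indices with the same form would give this nontrivial vanishing
      combination.\<close>
    define c where "c m = (if m = i then 1 else 0) - (if m = j then 1 else (0::real))" for m
    have "(\<Sum>m\<in>I. c m * l m x) = 0" if "x \<in> V" for x
    proof -
      have "(\<Sum>m\<in>I. c m * l m x) = (\<Sum>m\<in>I. if m = i then l i x else 0) - (\<Sum>m\<in>I. if m = j then l j x else 0)"
        unfolding sum_subtractf[symmetric] by (rule sum.cong) (auto simp: c_def)
      also have "\<dots> = l i x - l j x" using I ij by simp
      also have "\<dots> = 0" using fun_cong[OF ij(3), of x] that by (simp add: form_on_def)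
      finally show ?thesis .
    qed
    from ind[OF this ij(1)] show False using ij by (simp add: c_def)
  qed
  have "independent (?F ` I)"
  proof (rule independent_if_scalars_zero)
    show "finite (?F ` I)" using I by simp
    fix u g assume u: "(\<Sum>g\<in>?F ` I. u g *\<^sub>R g) = 0" and g: "g \<in> ?F ` I"
    then obtain i where i: "i \<in> I" "g = ?F i" by blast
    have "(\<Sum>i\<in>I. u (?F i) * l i x) = 0" if "x \<in> V" for x
      using fun_cong[OF u[unfolded sum.reindex[OF inj]], of x] that
      by (simp add: sum_fun_apply form_on_apply)
    from ind[OF this i(1)] show "u g = 0" using i by simp
  qed
  moreover have "span (?F ` I) = dual_space V"
  proof
    show "span (?F ` I) \<subseteq> dual_space V"
      using lin subspace_add[OF V] subspace_scale[OF V]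
      by (intro span_minimal subspace_dual_space)
         (auto simp: dual_space_def form_on_def linear_form_on_def)
  next
    show "dual_space V \<subseteq> span (?F ` I)"
    proof
      fix h assume h: "h \<in> dual_space V"
      then have hl: "linear_form_on V h" by (auto simp: dual_space_def linear_form_on_def)
      have "\<exists>c. \<forall>x\<in>V. h x = (\<Sum>i\<in>I. c i * l i x)"
      proof (rule linear_form_combination[OF I V hl lin])
        show "h x = 0" if "x \<in> V" "\<And>i. i \<in> I \<Longrightarrow> l i x = 0" for x
          using ker[OF that] linear_form_onD(2)[OF hl subspace_0[OF V], of 0] by simp
      qed
      then obtain c where c: "\<And>x. x \<in> V \<Longrightarrow> h x = (\<Sum>i\<in>I. c i * l i x)" by blast
      have "h = (\<Sum>i\<in>I. c i *\<^sub>R ?F i)"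
      proof
        show "h x = (\<Sum>i\<in>I. c i *\<^sub>R ?F i) x" for x
          using h c[of x] by (cases "x \<in> V") (simp_all add: sum_fun_apply form_on_def dual_space_def)
      qed
      then show "h \<in> span (?F ` I)"
        by (simp add: span_sum span_scale span_base)
    qed
  qed
  ultimately show ?thesis using inj unfolding unisolvent_def basis_of_def by blast
qed

section \<open>Finite dimension and finiteness of bases\<close>

lemma finite_dim_polys: "\<exists>F. finite F \<and> polys m s \<subseteq> span F"
proof -
  let ?A = "{\<alpha> :: 3 \<Rightarrow> nat. int (\<Sum>i\<in>UNIV. \<alpha> i) \<le> m}"
  have "?A \<subseteq> {\<alpha>. \<forall>i. \<alpha> i \<in> {..nat m}}"
  proof safe
    fix \<alpha> :: "3 \<Rightarrow> nat" and i assume "int (\<Sum>i\<in>UNIV. \<alpha> i) \<le> m"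
    moreover have "\<alpha> i \<le> (\<Sum>i\<in>UNIV. \<alpha> i)" by (rule member_le_sum) auto
    ultimately show "\<alpha> i \<le> nat m" by linarith
  qed
  moreover have "finite {\<alpha> :: 3 \<Rightarrow> nat. \<forall>i. \<alpha> i \<in> {..nat m}}"
    using finite_PiE[of "UNIV :: 3 set" "\<lambda>_. {..nat m}"] by (simp add: PiE_UNIV_domain Pi_def)
  ultimately have "finite ?A" by (rule finite_subset)
  then have "finite {monom3 \<alpha> | \<alpha>. int (\<Sum>i\<in>UNIV. \<alpha> i) \<le> m}" by simp
  then show ?thesis unfolding polys_alt linear_span_image[OF linear_restr, symmetric] by blast
qed

text \<open>The matrix factors come from an arbitrary \<open>X\<close>; expanding them in
  \<open>Basis\<close> leaves finitely many products.\<close>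

lemma finite_dim_polys_tensor: "\<exists>F. finite F \<and> polys_tensor m s X \<subseteq> span F"
proof -
  obtain F where F: "finite F" "polys m s \<subseteq> span F" using finite_dim_polys by blast
  let ?G = "(\<lambda>(p, B). \<lambda>x. p x *\<^sub>R B) ` (F \<times> (Basis :: (real^3^3) set))"
  have 1: "(\<lambda>x. p x *\<^sub>R B) \<in> span ?G" if "p \<in> span F" "B \<in> Basis" for p B
    using that(1)
  proof (induction rule: span_induct_alt)
    case base
    then show ?case using span_zero[of ?G] by (simp add: zero_fun_def)
  next
    case (step c p q)
    have "c *\<^sub>R (\<lambda>x. p x *\<^sub>R B) + (\<lambda>x. q x *\<^sub>R B) \<in> span ?G"
      using step that(2) by (intro span_add[OF span_scale[OF span_base]]) auto
    moreover have "c *\<^sub>R (\<lambda>x. p x *\<^sub>R B) + (\<lambda>x. q x *\<^sub>R B) = (\<lambda>x. (c *\<^sub>R p + q) x *\<^sub>R B)"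
      by (simp add: fun_eq_iff algebra_simps)
    ultimately show ?case by simp
  qed
  have "(\<lambda>x. p x *\<^sub>R A) \<in> span ?G" if "p \<in> polys m s" for p A
  proof -
    have "(\<lambda>x. p x *\<^sub>R A) = (\<Sum>B\<in>Basis. (A \<bullet> B) *\<^sub>R (\<lambda>x. p x *\<^sub>R B))"
    proof
      fix x
      have "p x *\<^sub>R A = p x *\<^sub>R (\<Sum>B\<in>Basis. (A \<bullet> B) *\<^sub>R B)" by (simp add: euclidean_representation)
      then show "p x *\<^sub>R A = (\<Sum>B\<in>Basis. (A \<bullet> B) *\<^sub>R (\<lambda>x. p x *\<^sub>R B)) x"
        by (simp add: sum_fun_apply scaleR_sum_right mult.commute)
    qed
    moreover have "p \<in> span F" using that F by blast
    ultimately show ?thesis using 1 by (auto intro!: span_sum span_scale)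
  qed
  then have "polys_tensor m s X \<subseteq> span ?G"
    unfolding polys_tensor_def by (intro span_minimal subspace_span) auto
  moreover have "finite ?G" using F(1) by (intro finite_imageI finite_cartesian_product) auto
  ultimately show ?thesis by blast
qed

text \<open>The given bases are arbitrary independent sets, while all later arguments sum over
  them.\<close>

lemma basis_of_finite:
  assumes "basis_of B V" "V \<subseteq> span F" "finite F"
  shows "finite B"
  using assms independent_span_bound[of F B] span_superset[of B] by (auto simp: basis_of_def)

lemma basis_of_sum_zero:
  assumes "basis_of B V" "finite B" "(\<Sum>b\<in>B. c b *\<^sub>R b) = 0" "b \<in> B"
  shows "c b = 0"
  using assms independentD[of B B c b] by (auto simp: basis_of_def)

lemma basis_of_memD: "basis_of B V \<Longrightarrow> b \<in> B \<Longrightarrow> b \<in> V"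
  using span_base by (auto simp: basis_of_def)

lemma basis_of_sum_mem: "basis_of B V \<Longrightarrow> (\<Sum>b\<in>B. c b *\<^sub>R b) \<in> V"
  by (auto simp: basis_of_def intro!: span_sum span_scale intro: span_base)

lemma basis_of_expand:
  assumes "basis_of B V" "finite B" "v \<in> V"
  obtains c where "v = (\<Sum>b\<in>B. c b *\<^sub>R b)"
  using assms span_finite[of B] by (auto simp: basis_of_def)

section \<open>Tetrahedra\<close>

lemma polys_tensor_extend:
  assumes "F \<in> polys_tensor m s X"
  obtains G where "G \<in> polys_tensor m UNIV X" "F = restr s G"
  using assms unfolding polys_tensor_restr[of m s X] by blast

lemma restr_in_polys_tensor: "G \<in> polys_tensor m UNIV X \<Longrightarrow> restr s G \<in> polys_tensor m s X"
  unfolding polys_tensor_restr[of m s X] by blast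

lemma polys_extend:
  assumes "p \<in> polys m s"
  obtains q where "q \<in> polys m UNIV" "p = restr s q"
  using assms unfolding polys_restr[of m s] by blast

lemma restr_in_polys: "q \<in> polys m UNIV \<Longrightarrow> restr s q \<in> polys m s"
  unfolding polys_restr[of m s] by blast

lemma restr_in [simp]: "x \<in> s \<Longrightarrow> restr s f x = f x"
  by (simp add: restr_def)

lemma polys_tensor_continuous: "F \<in> polys_tensor m s X \<Longrightarrow> t \<subseteq> s \<Longrightarrow> continuous_on t F"
proof -
  assume "F \<in> polys_tensor m s X" "t \<subseteq> s"
  then obtain G where G: "G \<in> polys_tensor m UNIV X" "F = restr s G" by (blast elim: polys_tensor_extend)
  show ?thesis
    using continuous_on_polys_tensor[OF G(1), of t] \<open>t \<subseteq> s\<close>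
    by (subst continuous_on_cong[OF refl, of t F G]) (auto simp: G(2) subset_iff)
qed

lemma polys_continuous: "p \<in> polys m s \<Longrightarrow> t \<subseteq> s \<Longrightarrow> continuous_on t p"
proof -
  assume "p \<in> polys m s" "t \<subseteq> s"
  then obtain q where q: "q \<in> polys m UNIV" "p = restr s q" by (blast elim: polys_extend)
  show ?thesis
    using continuous_on_polys[OF q(1), of t] \<open>t \<subseteq> s\<close>
    by (subst continuous_on_cong[OF refl, of t p q]) (auto simp: q(2) subset_iff)
qed

lemma polys_tensor_off: "F \<in> polys_tensor m s X \<Longrightarrow> x \<notin> s \<Longrightarrow> F x = 0"
  unfolding polys_tensor_restr[of m s X] by (auto simp: restr_def)

lemma polys_off: "p \<in> polys m s \<Longrightarrow> x \<notin> s \<Longrightarrow> p x = 0"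
  unfolding polys_restr[of m s] by (auto simp: restr_def)

section \<open>Weighted norm arguments for an abstract integral\<close>

lemma pos_functional_combination:
  fixes B :: "(real^3 \<Rightarrow> 'a::real_inner) set"
  assumes L: "pos_functional s L" and cont: "continuous_on s \<tau>" "\<And>b. b \<in> B \<Longrightarrow> continuous_on s b"
  shows "(\<Sum>b\<in>B. c b * L (\<lambda>x. \<tau> x \<bullet> b x)) = L (\<lambda>x. \<tau> x \<bullet> (\<Sum>b\<in>B. c b *\<^sub>R b) x)"
  using pos_functional_sum[OF L, of B "\<lambda>b x. \<tau> x \<bullet> b x" c] cont
  by (simp add: continuous_on_inner inner_sum_right sum_fun_apply)

text \<open>Since \<open>p\<close> is a combination of \<open>B\<close>, the hypotheses
  \<open>z\<close> add up to a zero integral of the inner product of \<open>\<tau>\<close> and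
  \<open>p\<close>, which is \<open>w\<close> times the squared norm of \<open>p\<close>. A general
  inner product space covers matrix fields and the scalar trace alike.\<close>

lemma weighted_zero:
  fixes B :: "(real^3 \<Rightarrow> 'a::real_inner) set"
  assumes L: "pos_functional s L" and B: "basis_of B W" "finite B"
    and cont: "\<And>b. b \<in> W \<Longrightarrow> continuous_on s b" "continuous_on s \<tau>"
    and p: "p \<in> W" "\<And>x. x \<in> s \<Longrightarrow> \<tau> x = w x *\<^sub>R p x" "\<And>x. x \<in> s \<Longrightarrow> 0 \<le> w x"
    and z: "\<And>b. b \<in> B \<Longrightarrow> L (\<lambda>x. \<tau> x \<bullet> b x) = 0" and x: "x \<in> s"
  shows "\<tau> x = 0"
proof -
  obtain c where c: "p = (\<Sum>b\<in>B. c b *\<^sub>R b)" using basis_of_expand[OF B p(1)] by blast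
  have "L (\<lambda>x. \<tau> x \<bullet> p x) = (\<Sum>b\<in>B. c b * L (\<lambda>x. \<tau> x \<bullet> b x))"
    unfolding c using cont basis_of_memD[OF B(1)]
    by (intro pos_functional_combination[OF L, symmetric]) auto
  then have 0: "L (\<lambda>x. \<tau> x \<bullet> p x) = 0" using z by simp
  have "\<tau> x \<bullet> p x = 0"
  proof (rule pos_functionalD(4)[OF L _ _ 0 x])
    show "continuous_on s (\<lambda>x. \<tau> x \<bullet> p x)" by (intro continuous_on_inner cont p)
    show "0 \<le> \<tau> x \<bullet> p x" if "x \<in> s" for x using p(2,3)[OF that] by simp
  qed
  \<comment> \<open>As \<open>w x\<close> times the squared norm of \<open>p x\<close> is zero, one
    of the two factors of \<open>w x *\<^sub>R p x\<close> vanishes.\<close>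
  then show ?thesis using p(2)[OF x] by simp
qed

text \<open>The left side of \<open>z\<close> is a combination of forms at the field
  \<open>w\<close> times \<open>p\<close>, where \<open>p\<close> is built from the same
  coefficients; it collapses to the weighted norm of \<open>p\<close>. The weight may vanish on part
  of \<open>s\<close>, whence \<open>dense\<close>.\<close>

lemma weighted_independent:
  fixes B :: "(real^3 \<Rightarrow> 'a::real_inner) set"
  assumes L: "pos_functional s L" and B: "basis_of B W" "finite B"
    and cont: "\<And>b. b \<in> W \<Longrightarrow> continuous_on s b" "continuous_on s w"
    and w: "\<And>x. x \<in> s \<Longrightarrow> 0 \<le> w x"
    and dense: "\<And>p. p \<in> W \<Longrightarrow> (\<And>x. x \<in> s \<Longrightarrow> w x \<noteq> 0 \<Longrightarrow> p x = 0) \<Longrightarrow> p = 0"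
    and z: "(\<Sum>b\<in>B. c b * L (\<lambda>x. (w x *\<^sub>R (\<Sum>b\<in>B. c b *\<^sub>R b) x) \<bullet> b x)) = 0"
    and b: "b \<in> B"
  shows "c b = 0"
proof -
  define p where "p = (\<Sum>b\<in>B. c b *\<^sub>R b)"
  have pW: "p \<in> W" unfolding p_def by (rule basis_of_sum_mem[OF B(1)])
  have "(\<Sum>b\<in>B. c b * L (\<lambda>x. (w x *\<^sub>R p x) \<bullet> b x)) = L (\<lambda>x. (w x *\<^sub>R p x) \<bullet> (\<Sum>b\<in>B. c b *\<^sub>R b) x)"
    using cont pW basis_of_memD[OF B(1)]
    by (intro pos_functional_combination[OF L] continuous_on_scaleR) auto
  then have 0: "L (\<lambda>x. (w x *\<^sub>R p x) \<bullet> p x) = 0" using z unfolding p_def[symmetric] by simp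
  have "(w x *\<^sub>R p x) \<bullet> p x = 0" if "x \<in> s" for x
  proof (rule pos_functionalD(4)[OF L _ _ 0 that])
    show "continuous_on s (\<lambda>x. (w x *\<^sub>R p x) \<bullet> p x)"
      by (intro continuous_on_inner continuous_on_scaleR cont pW)
    show "0 \<le> (w x *\<^sub>R p x) \<bullet> p x" if "x \<in> s" for x using w[OF that] by simp
  qed
  then have "p = 0" by (intro dense[OF pW]) auto
  then show ?thesis unfolding p_def by (rule basis_of_sum_zero[OF B _ b])
qed

section \<open>The faces of a tetrahedron as hulls of vertex sets\<close>

locale tetrahedron = barycentric C lam for C lam +
  fixes T :: "(real^3) set"
  assumes aff_indep: "\<not> affine_dependent C" and card_C: "card C = 4" and T_eq: "T = convex hull C"
begin

lemma extreme_iff: "x extreme_point_of T \<longleftrightarrow> x \<in> C"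
  unfolding T_eq using extreme_point_of_convex_hull_affine_independent[OF aff_indep] by blast

lemma aff_dim_hull: "S \<subseteq> C \<Longrightarrow> aff_dim (convex hull S) = int (card S) - 1"
  using affine_independent_subset[OF aff_indep, of S] aff_dim_affine_independent[of S] by (simp add: aff_dim_convex_hull)

lemma edge_iff: "e edge_of T \<longleftrightarrow> (\<exists>S\<subseteq>C. card S = 2 \<and> e = convex hull S)"
  unfolding edge_of_def T_eq face_of_convex_hull_affine_independent[OF aff_indep]
  by (auto simp: aff_dim_hull)

lemma facet_iff: "f facet_of T \<longleftrightarrow> (\<exists>S\<subseteq>C. card S = 3 \<and> f = convex hull S)"
proof -
  have "aff_dim T = 3" using aff_dim_hull[of C] card_C by (simp add: T_eq)
  then have "f facet_of T \<longleftrightarrow> f face_of T \<and> f \<noteq> {} \<and> aff_dim f = 2"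
    by (simp add: facet_of_def)
  also have "\<dots> \<longleftrightarrow> (\<exists>S\<subseteq>C. card S = 3 \<and> f = convex hull S)"
    unfolding T_eq face_of_convex_hull_affine_independent[OF aff_indep]
    by (auto simp: aff_dim_hull)
  finally show ?thesis .
qed

lemma finite_sub: "S \<subseteq> C \<Longrightarrow> finite S"
  using finite_vertices finite_subset by blast

lemma hull_subset_T: "S \<subseteq> C \<Longrightarrow> convex hull S \<subseteq> T"
  unfolding T_eq by (rule hull_mono)

lemma compact_hull: "S \<subseteq> C \<Longrightarrow> compact (convex hull S)"
  by (intro compact_convex_hull finite_imp_compact finite_sub)

lemma pos_edge: "S \<subseteq> C \<Longrightarrow> card S = 2 \<Longrightarrow> pos_functional (convex hull S) (edge_integral (convex hull S))"
  by (intro pos_functional_edge compact_hull convex_convex_hull) (simp add: aff_dim_hull)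

lemma pos_face: "S \<subseteq> C \<Longrightarrow> card S = 3 \<Longrightarrow> pos_functional (convex hull S) (face_integral (convex hull S))"
  by (intro pos_functional_face compact_hull convex_convex_hull) (simp add: aff_dim_hull)

lemma pos_T: "pos_functional T (\<lambda>g. LINT x : T | lborel. g x)"
  unfolding T_eq
  by (intro pos_functional_volume compact_hull convex_convex_hull) (simp_all add: aff_dim_hull card_C)

text \<open>The trace condition in \<open>bubbles\<close> refers to the frontier, the other
  arguments to vertex sets. In full dimension the frontier is the relative frontier, which for a
  simplex is the union of its facets.\<close>

lemma frontier_T: "frontier T = (\<Union>v\<in>C. convex hull (C - {v}))"
proof -
  have "affine hull T = UNIV"
    using aff_dim_eq_full[of T] aff_dim_hull[of C] card_C by (simp add: T_eq)
  then have "frontier T = rel_frontier T"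
    unfolding rel_frontier_def frontier_def by (simp add: rel_interior_interior)
  then show ?thesis unfolding T_eq rel_frontier_convex_hull_cases[OF aff_indep] by blast
qed

text \<open>For the vertex \<open>v\<close> off the face, \<open>lam v\<close> is constant on the
  face, so its linear part kills the tangent space; yet \<open>lam v\<close> differs by one between
  \<open>v\<close> and a vertex of the face.\<close>

lemma tangent_face_neq:
  assumes "S \<subseteq> C" "card S = 3"
  shows "tangent (convex hull S) \<noteq> UNIV"
proof
  assume U: "tangent (convex hull S) = UNIV"
  obtain v where v: "v \<in> C" "v \<notin> S" using assms card_C by (metis numeral_eq_iff semiring_norm(88,90) subsetI subset_antisym)
  obtain u where u: "u \<in> S" using assms by fastforce
  obtain g c where g: "linear g" "\<And>x. lam v x = g x + c" using lam_affine[OF v(1)] by blast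
  have "g y = 0" if "y \<in> tangent (convex hull S)" for y
  proof (rule linear_eq_0_on_span[OF g(1) _ that[unfolded tangent_def]])
    fix b assume "b \<in> {x - y |x y. x \<in> convex hull S \<and> y \<in> convex hull S}"
    then obtain x y where b: "b = x - y" "x \<in> convex hull S" "y \<in> convex hull S" by blast
    then show "g b = 0"
      using hull_barycentric(2)[OF assms(1) b(2) v] hull_barycentric(2)[OF assms(1) b(3) v] g
      by (simp add: linear_diff)
  qed
  then have "lam v v = lam v u" using g U by simp
  then show False using lam_vertex[OF v(1) v(1)] lam_vertex[OF v(1) subsetD[OF assms(1) u]] v u
    by (auto split: if_splits)
qed

end

section \<open>The common kernel of the degrees of freedom\<close>

locale dof_bases = tetrahedron C lam T for C lam T +
  fixes k :: int and BV BE BF BR BT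
  assumes k: "k \<ge> 1"
    and BV: "\<And>x. x extreme_point_of T \<Longrightarrow> basis_of (BV x) sym3"
    and BE: "\<And>e. e edge_of T \<Longrightarrow> basis_of (BE e) (polys_tensor (k - 2) e sym3)"
    and BF: "\<And>f. f facet_of T \<Longrightarrow> basis_of (BF f) (polys_tensor (k - 3) f (sym_tangent f))"
    and BR: "\<And>f. f facet_of T \<Longrightarrow> basis_of (BR f) (polys (k - 3) f)"
    and BT: "basis_of BT (bubbles k T)"
begin

abbreviation "V \<equiv> polys_tensor k T sym3"
abbreviation "I \<equiv> dofs T BV BE BF BR BT"

lemma basisV: "v \<in> C \<Longrightarrow> basis_of (BV v) sym3"
  using BV extreme_iff by blast

lemma basisE: "S \<subseteq> C \<Longrightarrow> card S = 2 \<Longrightarrow> basis_of (BE (convex hull S)) (polys_tensor (k - 2) (convex hull S) sym3)"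
  using BE edge_iff by blast

lemma basisF: "S \<subseteq> C \<Longrightarrow> card S = 3 \<Longrightarrow>
    basis_of (BF (convex hull S)) (polys_tensor (k - 3) (convex hull S) (sym_tangent (convex hull S)))"
  using BF facet_iff by blast

lemma basisR: "S \<subseteq> C \<Longrightarrow> card S = 3 \<Longrightarrow> basis_of (BR (convex hull S)) (polys (k - 3) (convex hull S))"
  using BR facet_iff by blast

lemma bubbles_subset: "bubbles k T \<subseteq> V"
  by (auto simp: bubbles_def)

lemma finite_bases:
  shows "v \<in> C \<Longrightarrow> finite (BV v)"
    and "S \<subseteq> C \<Longrightarrow> card S = 2 \<Longrightarrow> finite (BE (convex hull S))"
    and "S \<subseteq> C \<Longrightarrow> card S = 3 \<Longrightarrow> finite (BF (convex hull S))"
    and "S \<subseteq> C \<Longrightarrow> card S = 3 \<Longrightarrow> finite (BR (convex hull S))"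
    and "finite BT"
proof -
  show "finite (BV v)" if "v \<in> C"
    using independent_imp_finite basisV[OF that] by (auto simp: basis_of_def)
  show "finite (BE (convex hull S))" if "S \<subseteq> C" "card S = 2"
    using basis_of_finite[OF basisE[OF that]] finite_dim_polys_tensor by blast
  show "finite (BF (convex hull S))" if "S \<subseteq> C" "card S = 3"
    using basis_of_finite[OF basisF[OF that]] finite_dim_polys_tensor by blast
  show "finite (BR (convex hull S))" if "S \<subseteq> C" "card S = 3"
    using basis_of_finite[OF basisR[OF that]] finite_dim_polys by blast
  show "finite BT"
    using basis_of_finite[OF BT] finite_dim_polys_tensor bubbles_subset by (metis subset_trans)
qed

text \<open>Indexes edges and faces by their vertex sets, which are also the labels of the bubbles
  \<open>bub S\<close>.\<close>

lemma dofs_cases [consumes 1, case_names Vertex Edge Face FaceTrace Interior]: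
  assumes "i \<in> I"
  obtains v S where "i = Vertex v S" "v \<in> C" "S \<in> BV v"
  | S p where "i = Edge (convex hull S) p" "S \<subseteq> C" "card S = 2" "p \<in> BE (convex hull S)"
  | S b where "i = Face (convex hull S) b" "S \<subseteq> C" "card S = 3" "b \<in> BF (convex hull S)"
  | S p where "i = FaceTrace (convex hull S) p" "S \<subseteq> C" "card S = 3" "p \<in> BR (convex hull S)"
  | b where "i = Interior b" "b \<in> BT"
  using assms unfolding dofs_def extreme_iff edge_iff facet_iff by blast

lemma dofs_intros:
  "v \<in> C \<Longrightarrow> A \<in> BV v \<Longrightarrow> Vertex v A \<in> I"
  "S \<subseteq> C \<Longrightarrow> card S = 2 \<Longrightarrow> p \<in> BE (convex hull S) \<Longrightarrow> Edge (convex hull S) p \<in> I"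
  "S \<subseteq> C \<Longrightarrow> card S = 3 \<Longrightarrow> b \<in> BF (convex hull S) \<Longrightarrow> Face (convex hull S) b \<in> I"
  "S \<subseteq> C \<Longrightarrow> card S = 3 \<Longrightarrow> q \<in> BR (convex hull S) \<Longrightarrow> FaceTrace (convex hull S) q \<in> I"
  "b' \<in> BT \<Longrightarrow> Interior b' \<in> I"
proof -
  have e: "convex hull S edge_of T" if "S \<subseteq> C" "card S = 2" for S using that edge_iff by blast
  have f: "convex hull S facet_of T" if "S \<subseteq> C" "card S = 3" for S using that facet_iff by blast
  show "v \<in> C \<Longrightarrow> A \<in> BV v \<Longrightarrow> Vertex v A \<in> I" by (simp add: dofs_def extreme_iff)
  show "S \<subseteq> C \<Longrightarrow> card S = 2 \<Longrightarrow> p \<in> BE (convex hull S) \<Longrightarrow> Edge (convex hull S) p \<in> I"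
    by (simp add: dofs_def e)
  show "S \<subseteq> C \<Longrightarrow> card S = 3 \<Longrightarrow> b \<in> BF (convex hull S) \<Longrightarrow> Face (convex hull S) b \<in> I"
    "S \<subseteq> C \<Longrightarrow> card S = 3 \<Longrightarrow> q \<in> BR (convex hull S) \<Longrightarrow> FaceTrace (convex hull S) q \<in> I"
    by (simp_all add: dofs_def f)
  show "b' \<in> BT \<Longrightarrow> Interior b' \<in> I" by (simp add: dofs_def)
qed

lemma finite_dofs: "finite I"
proof -
  let ?F = "\<lambda>n. {S \<in> Pow C. card S = n}"
  let ?U1 = "\<Union>v\<in>C. Vertex v ` BV v"
  let ?U2 = "\<Union>S\<in>?F 2. Edge (convex hull S) ` BE (convex hull S)"
  let ?U3 = "\<Union>S\<in>?F 3. Face (convex hull S) ` BF (convex hull S)"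
  let ?U4 = "\<Union>S\<in>?F 3. FaceTrace (convex hull S) ` BR (convex hull S)"
  let ?U = "?U1 \<union> (?U2 \<union> (?U3 \<union> (?U4 \<union> Interior ` BT)))"
  have "I \<subseteq> ?U"
  proof
    fix i assume "i \<in> I"
    then show "i \<in> ?U"
    proof (cases rule: dofs_cases)
      case (Vertex v S)
      then have "i \<in> ?U1" by (intro UN_I[of v]) auto
      then show ?thesis by (rule UnI1)
    next
      case (Edge S p)
      then have "i \<in> ?U2" by (intro UN_I[of S]) auto
      then show ?thesis by (intro UnI2[OF UnI1])
    next
      case (Face S p)
      then have "i \<in> ?U3" by (intro UN_I[of S]) auto
      then show ?thesis by (intro UnI2[OF UnI2[OF UnI1]])
    next
      case (FaceTrace S p)
      then have "i \<in> ?U4" by (intro UN_I[of S]) auto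
      then show ?thesis by (intro UnI2[OF UnI2[OF UnI2[OF UnI1]]])
    next
      case (Interior b)
      then show ?thesis by (intro UnI2[OF UnI2[OF UnI2[OF UnI2]]]) simp
    qed
  qed
  moreover have "finite ?U"
    using finite_bases finite_vertices by simp
  ultimately show ?thesis by (rule finite_subset)
qed

lemma V_D:
  assumes "\<sigma> \<in> V"
  shows "\<sigma> x \<in> sym3" "x \<notin> T \<Longrightarrow> \<sigma> x = 0" "s \<subseteq> T \<Longrightarrow> continuous_on s \<sigma>"
proof -
  obtain F where F: "F \<in> polys_tensor k UNIV sym3" "\<sigma> = restr T F"
    by (rule polys_tensor_extend[OF assms])
  show "\<sigma> x \<in> sym3" using polys_tensor_UNIV_D(2)[OF subspace_sym3 F(1)] subspace_0[OF subspace_sym3]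
    by (auto simp: F(2) restr_def)
  show "x \<notin> T \<Longrightarrow> \<sigma> x = 0" by (simp add: F(2) restr_def)
  show "s \<subseteq> T \<Longrightarrow> continuous_on s \<sigma>" using assms polys_tensor_continuous by blast
qed

lemma linear_trace: "linear (trace :: real^3^3 \<Rightarrow> real)"
  by (intro linearI) (simp_all add: trace_eq_inner inner_add_left)

lemma continuous_conj: "continuous_on (s :: (real^3) set) F \<Longrightarrow> continuous_on s (\<lambda>x. P ** F x ** Q)" for P Q :: "real^3^3"
  using linear_continuous_on_compose[OF _ linear_conj[of P Q], of s F] by simp

lemma continuous_trace: "continuous_on s F \<Longrightarrow> continuous_on s (\<lambda>x. trace (F x :: real^3^3))"
  unfolding trace_eq_inner by (intro continuous_intros)

text \<open>One statement for all integrated forms: \<open>h\<close> is the identity, the tangential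
  conjugation or the trace.\<close>

lemma functional_linear_form:
  fixes h :: "real^3^3 \<Rightarrow> 'a::euclidean_space"
  assumes L: "pos_functional s L" and sT: "s \<subseteq> T" and h: "linear h" and b: "continuous_on s b"
  shows "linear_form_on V (\<lambda>\<sigma>. L (\<lambda>x. h (\<sigma> x) \<bullet> b x))"
proof -
  have c: "continuous_on s (\<lambda>x. h (\<sigma> x) \<bullet> b x)" if "\<sigma> \<in> V" for \<sigma>
    using linear_continuous_on_compose[OF V_D(3)[OF that sT] h] b
    by (rule continuous_on_inner)
  show ?thesis unfolding linear_form_on_def
    using pos_functionalD(2,3)[OF L c]
    by (auto simp: linear_add[OF h] linear_scale[OF h] inner_add_left c pos_functionalD(2)[OF L c c])
qed

lemma dof_form_linear:
  assumes "i \<in> I" shows "linear_form_on V (dof_form T i)"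
  using assms
proof (cases rule: dofs_cases)
  case (Vertex v S)
  then show ?thesis by (simp add: linear_form_on_def inner_add_left)
next
  case (Edge S p)
  have "continuous_on (convex hull S) p"
    using basis_of_memD[OF basisE Edge(4)] Edge polys_tensor_continuous by blast
  from functional_linear_form[OF pos_edge hull_subset_T linear_ident this] show ?thesis
    using Edge by (simp add: dof_form.simps[abs_def])
next
  case (Face S b)
  have "continuous_on (convex hull S) b"
    using basis_of_memD[OF basisF Face(4)] Face polys_tensor_continuous by blast
  from functional_linear_form[OF pos_face hull_subset_T linear_conj this] show ?thesis
    using Face by (simp add: dof_form.simps[abs_def])
next
  case (FaceTrace S p)
  have "continuous_on (convex hull S) p"
    using basis_of_memD[OF basisR FaceTrace(4)] FaceTrace polys_continuous by blast
  from functional_linear_form[OF pos_face hull_subset_T linear_trace this] show ?thesis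
    using FaceTrace by (simp add: dof_form.simps[abs_def])
next
  case (Interior b)
  have "continuous_on T b"
    using basis_of_memD[OF BT Interior(2)] bubbles_subset V_D(3) by blast
  from functional_linear_form[OF pos_T order_refl linear_ident this] show ?thesis
    using Interior by (simp add: dof_form.simps[abs_def])
qed

lemma hull_card2: 
  assumes "card S = 2" "v \<in> S" "x \<in> convex hull (S - {v})"
  shows "x \<in> S"
proof -
  have "finite S" using assms(1) card.infinite by force
  then have "card (S - {v}) = 1" using assms by simp
  then obtain w where "S - {v} = {w}" by (rule card_1_singletonE)
  then show ?thesis using assms(3) by auto
qed

lemma hull_remove:
  assumes "S \<subseteq> C" "card S = Suc n" "v \<in> S"
  shows "S - {v} \<subseteq> C" "card (S - {v}) = n"
  using assms finite_sub[OF assms(1)] by auto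

lemma kernel:
  assumes \<sigma>: "\<sigma> \<in> V" and z: "\<And>i. i \<in> I \<Longrightarrow> dof_form T i \<sigma> = 0"
  shows "\<sigma> = 0"
proof -
  obtain F where F: "F \<in> polys_tensor k UNIV sym3" and \<sigma>F: "\<sigma> = restr T F"
    by (rule polys_tensor_extend[OF \<sigma>])
  \<comment> \<open>The division lemma takes an arbitrary matrix field and learns its range from the
    values on the hull.\<close>
  have FU: "F \<in> polys_tensor k UNIV UNIV" using F polys_tensor_mono[of k k sym3 UNIV] by blast
  have Fs: "F x \<in> sym3" for x by (rule polys_tensor_UNIV_D(2)[OF subspace_sym3 F])
  have F_eq: "\<sigma> x = F x" if "S \<subseteq> C" "x \<in> convex hull S" for x S
    using hull_subset_T[OF that(1)] that(2) by (auto simp: \<sigma>F)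
  have vert: "\<sigma> v = 0" if v: "v \<in> C" for v
  proof -
    obtain c where c: "\<sigma> v = (\<Sum>A\<in>BV v. c A *\<^sub>R A)"
      using basis_of_expand[OF basisV[OF v] finite_bases(1)[OF v] V_D(1)[OF \<sigma>, of v]] by blast
    have "\<sigma> v \<bullet> A = 0" if "A \<in> BV v" for A using z[OF dofs_intros(1)[OF v that]] by simp
    then have "\<sigma> v \<bullet> (\<Sum>A\<in>BV v. c A *\<^sub>R A) = 0" by (simp add: inner_sum_right)
    then have "\<sigma> v \<bullet> \<sigma> v = 0" using c by simp
    then show ?thesis by simp
  qed
  have edge: "\<sigma> x = 0" if S: "S \<subseteq> C" "card S = 2" and x: "x \<in> convex hull S" for S x
  proof -
    let ?e = "convex hull S"
    have F0: "F x = 0" if "v \<in> S" "x \<in> convex hull (S - {v})" for v x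
      using hull_card2[OF S(2) that] vert[of x] F_eq[OF S(1), of x] S(1) hull_inc[of x S] by auto
    have "\<exists>G\<in>polys_tensor (k - int (card S)) UNIV sym3. \<forall>x\<in>?e. F x = bub S x *\<^sub>R G x"
      by (rule polys_tensor_div_bub[OF FU subspace_sym3 S(1)], simp add: S(2), rule Fs, erule F0)
    \<comment> \<open>For \<open>k = 1\<close> this degree is negative and \<open>G\<close> is zero:
      an affine field vanishing at both ends of an edge vanishes on it.\<close>
    then obtain G where G: "G \<in> polys_tensor (k - 2) UNIV sym3" "\<And>x. x \<in> ?e \<Longrightarrow> F x = bub S x *\<^sub>R G x"
      unfolding S(2) by auto
    show ?thesis
    proof (rule weighted_zero[OF pos_edge[OF S] basisE[OF S] finite_bases(2)[OF S] _ _ _ _ _ _ x])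
      show "continuous_on ?e b" if "b \<in> polys_tensor (k - 2) ?e sym3" for b
        by (rule polys_tensor_continuous[OF that order_refl])
      show "continuous_on ?e \<sigma>" by (rule V_D(3)[OF \<sigma> hull_subset_T[OF S(1)]])
      show "restr ?e G \<in> polys_tensor (k - 2) ?e sym3" by (rule restr_in_polys_tensor[OF G(1)])
      show "\<sigma> x = bub S x *\<^sub>R restr ?e G x" if "x \<in> ?e" for x
        using that F_eq[OF S(1) that] G(2) by simp
      show "0 \<le> bub S x" if "x \<in> ?e" for x by (rule bub_nonneg[OF S(1) S(1) that])
      show "edge_integral ?e (\<lambda>x. \<sigma> x \<bullet> b x) = 0" if "b \<in> BE ?e" for b
        using z[OF dofs_intros(2)[OF S that]] by simp
    qed
  qed
  have face: "tangent_proj (convex hull S) ** \<sigma> x ** tangent_proj (convex hull S) = 0 \<and> trace (\<sigma> x) = 0"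
    if S: "S \<subseteq> C" "card S = 3" and x: "x \<in> convex hull S" for S x
  proof
    let ?f = "convex hull S"
    let ?h = "\<lambda>A. tangent_proj ?f ** A ** tangent_proj ?f"
    have F0: "F x = 0" if "v \<in> S" "x \<in> convex hull (S - {v})" for v x
      using edge[OF hull_remove[OF S(1) _ that(1)] that(2)] S(2)
        F_eq[OF hull_remove(1)[OF S(1) _ that(1)] that(2)] by simp
    \<comment> \<open>The tangential part is divided as a field of its own, so that the quotient
      lies in \<open>sym_tangent ?f\<close> pointwise and is an admissible test field for the
      \<open>Face\<close> forms.\<close>
    have hF: "(\<lambda>x. ?h (F x)) \<in> polys_tensor k UNIV UNIV"
      by (rule polys_tensor_linear[OF linear_conj F subspace_UNIV UNIV_I])
    have h0: "?h (F x) = 0" if "v \<in> S" "x \<in> convex hull (S - {v})" for v x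
      using F0[OF that] by simp
    have "\<exists>G\<in>polys_tensor (k - int (card S)) UNIV (sym_tangent ?f). \<forall>x\<in>?f. ?h (F x) = bub S x *\<^sub>R G x"
      by (rule polys_tensor_div_bub[OF hF subspace_sym_tangent S(1)], simp add: S(2),
          rule tangent_proj_conj_sym3[OF Fs], erule h0)
    then obtain G where G: "G \<in> polys_tensor (k - 3) UNIV (sym_tangent ?f)"
      "\<And>x. x \<in> ?f \<Longrightarrow> ?h (F x) = bub S x *\<^sub>R G x"
      unfolding S(2) by auto
    show "?h (\<sigma> x) = 0"
    proof (rule weighted_zero[OF pos_face[OF S] basisF[OF S] finite_bases(3)[OF S] _ _ _ _ _ _ x])
      show "continuous_on ?f b" if "b \<in> polys_tensor (k - 3) ?f (sym_tangent ?f)" for b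
        by (rule polys_tensor_continuous[OF that order_refl])
      show "continuous_on ?f (\<lambda>x. ?h (\<sigma> x))"
        by (rule continuous_conj[OF V_D(3)[OF \<sigma> hull_subset_T[OF S(1)]]])
      show "restr ?f G \<in> polys_tensor (k - 3) ?f (sym_tangent ?f)" by (rule restr_in_polys_tensor[OF G(1)])
      show "?h (\<sigma> x) = bub S x *\<^sub>R restr ?f G x" if "x \<in> ?f" for x
        using that F_eq[OF S(1) that] G(2) by simp
      show "0 \<le> bub S x" if "x \<in> ?f" for x by (rule bub_nonneg[OF S(1) S(1) that])
      show "face_integral ?f (\<lambda>x. ?h (\<sigma> x) \<bullet> b x) = 0" if "b \<in> BF ?f" for b
        using z[OF dofs_intros(3)[OF S that]] by simp
    qed
    have t0: "trace (F x) = 0" if "v \<in> S" "x \<in> convex hull (S - {v})" for v x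
      using F0[OF that] by (simp add: trace_eq_inner)
    have "\<exists>q\<in>polys (k - int (card S)) UNIV. \<forall>x\<in>?f. trace (F x) = bub S x * q x"
      by (rule polys_div_bub[OF polys_trace[OF F] S(1)], simp add: S(2), erule t0)
    then obtain q where q: "q \<in> polys (k - 3) UNIV" "\<And>x. x \<in> ?f \<Longrightarrow> trace (F x) = bub S x * q x"
      unfolding S(2) by auto
    show "trace (\<sigma> x) = 0"
    proof (rule weighted_zero[OF pos_face[OF S] basisR[OF S] finite_bases(4)[OF S] _ _ _ _ _ _ x])
      show "continuous_on ?f b" if "b \<in> polys (k - 3) ?f" for b
        by (rule polys_continuous[OF that order_refl])
      show "continuous_on ?f (\<lambda>x. trace (\<sigma> x))"
        by (rule continuous_trace[OF V_D(3)[OF \<sigma> hull_subset_T[OF S(1)]]])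
      show "restr ?f q \<in> polys (k - 3) ?f" by (rule restr_in_polys[OF q(1)])
      show "trace (\<sigma> x) = bub S x *\<^sub>R restr ?f q x" if "x \<in> ?f" for x
        using that F_eq[OF S(1) that] q(2) by simp
      show "0 \<le> bub S x" if "x \<in> ?f" for x by (rule bub_nonneg[OF S(1) S(1) that])
      show "face_integral ?f (\<lambda>x. trace (\<sigma> x) \<bullet> b x) = 0" if "b \<in> BR ?f" for b
        using z[OF dofs_intros(4)[OF S that]] by simp
    qed
  qed
  have "trace (\<sigma> x) = 0" if x: "x \<in> frontier T" for x
  proof -
    obtain v where v: "v \<in> C" "x \<in> convex hull (C - {v})" using x unfolding frontier_T by blast
    then show ?thesis using face[OF hull_remove[OF order_refl _ v(1), of 3]] card_C by simp
  qed
  then have "\<sigma> \<in> bubbles k T"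
    unfolding bubbles_def mem_Collect_eq edge_iff facet_iff
    using \<sigma> face edge by auto
  have "\<sigma> x = 0" if "x \<in> T" for x
  \<comment> \<open>Being a bubble, \<open>\<sigma>\<close> is itself an admissible test field and
    plays the part of \<open>p\<close> with weight 1.\<close>
  proof (rule weighted_zero[OF pos_T BT finite_bases(5) _ _ \<open>\<sigma> \<in> bubbles k T\<close> _ _ _ that])
    show "continuous_on T b" if "b \<in> bubbles k T" for b
      using that bubbles_subset V_D(3) by blast
    show "continuous_on T \<sigma>" using V_D(3)[OF \<sigma>] by blast
    show "\<sigma> x = 1 *\<^sub>R \<sigma> x" for x by simp
    show "(LINT x:T|lborel. \<sigma> x \<bullet> b x) = 0" if "b \<in> BT" for b
      using z[OF dofs_intros(5)[OF that]] by simp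
  qed simp
  then show ?thesis using V_D(2)[OF \<sigma>] by (auto simp: fun_eq_iff)
qed

end

section \<open>Independence of the degrees of freedom\<close>

context dof_bases begin

definition test_field :: "(real^3) set \<Rightarrow> (real^3 \<Rightarrow> real^3^3) \<Rightarrow> real^3 \<Rightarrow> real^3^3" where
  "test_field W M = restr T (\<lambda>x. bub W x *\<^sub>R M x)"

text \<open>The bubble uses up \<open>n\<close> of the \<open>k\<close> degrees; this matches the
  moment degrees \<open>k - 2\<close> on edges and \<open>k - 3\<close> on faces.\<close>

lemma test_mem:
  assumes "W \<subseteq> C" "card W = n" "M \<in> polys_tensor (k - int n) UNIV sym3"
  shows "test_field W M \<in> V"
  using polys_tensor_mult[OF subspace_sym3 bub_polys[OF assms(1)] assms(3)] assms(2)
  unfolding test_field_def by (intro restr_in_polys_tensor) simp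

lemma test_hull: "S \<subseteq> C \<Longrightarrow> x \<in> convex hull S \<Longrightarrow> test_field W M x = bub W x *\<^sub>R M x"
  using hull_subset_T[of S] by (auto simp: test_field_def)

text \<open>A set \<open>S\<close> other than \<open>W\<close> with at most as many elements cannot
  contain \<open>W\<close>. Hence the forms on other faces of the same dimension, and on all faces
  of lower dimension, do not see the field.\<close>

lemma test_vanish:
  assumes "W \<subseteq> C" "S \<subseteq> C" "card S \<le> card W" "S \<noteq> W" "x \<in> convex hull S"
  shows "test_field W M x = 0"
proof -
  have "\<not> W \<subseteq> S" using assms(3,4) card_seteq[OF finite_sub[OF assms(2)]] by blast
  then show ?thesis using bub_zero[OF assms(1,2) _ assms(5)] test_hull[OF assms(2,5)] by simp
qed

lemma test_Vertex: "W \<subseteq> C \<Longrightarrow> v \<in> C \<Longrightarrow> 1 \<le> card W \<Longrightarrow> {v} \<noteq> W \<Longrightarrow> dof_form T (Vertex v A) (test_field W M) = 0"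
  using test_vanish[of W "{v}" v M] by simp

lemma test_Edge:
  assumes "W \<subseteq> C" "S \<subseteq> C" "card S = 2" "2 \<le> card W" "S \<noteq> W"
  shows "dof_form T (Edge (convex hull S) p) (test_field W M) = 0"
  unfolding dof_form.simps
  by (rule pos_functional_0[OF pos_edge[OF assms(2,3)]]) (simp add: test_vanish[OF assms(1,2) _ assms(5)] assms(3,4))

lemma test_Face:
  assumes "W \<subseteq> C" "S \<subseteq> C" "card S = 3" "3 \<le> card W" "S \<noteq> W"
  shows "dof_form T (Face (convex hull S) b) (test_field W M) = 0"
    "dof_form T (FaceTrace (convex hull S) q) (test_field W M) = 0"
proof -
  have z: "test_field W M x = 0" if "x \<in> convex hull S" for x
    using test_vanish[OF assms(1,2) _ assms(5) that] assms(3,4) by simp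
  show "dof_form T (Face (convex hull S) b) (test_field W M) = 0"
    unfolding dof_form.simps by (rule pos_functional_0[OF pos_face[OF assms(2,3)]]) (simp add: z)
  show "dof_form T (FaceTrace (convex hull S) q) (test_field W M) = 0"
    unfolding dof_form.simps
    by (rule pos_functional_0[OF pos_face[OF assms(2,3)]]) (simp add: z trace_eq_inner)
qed

text \<open>The conditions in \<open>bubbles\<close> annihilate the integrands of the edge and face
  forms; vertex values are covered because every vertex lies on an edge.\<close>

lemma bubble_dofs:
  assumes \<sigma>: "\<sigma> \<in> bubbles k T" and i: "i \<in> I" "i \<notin> Interior ` BT"
  shows "dof_form T i \<sigma> = 0"
proof -
  have e: "\<sigma> x = 0" if "S \<subseteq> C" "card S = 2" "x \<in> convex hull S" for S x
    using \<sigma> that edge_iff unfolding bubbles_def by blast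
  have f: "tangent_proj (convex hull S) ** \<sigma> x ** tangent_proj (convex hull S) = 0"
    "trace (\<sigma> x) = 0" if S: "S \<subseteq> C" "card S = 3" and x: "x \<in> convex hull S" for S x
  proof -
    have fc: "convex hull S facet_of T" using S facet_iff by blast
    then show "tangent_proj (convex hull S) ** \<sigma> x ** tangent_proj (convex hull S) = 0"
      using \<sigma> x unfolding bubbles_def by blast
    have "S \<noteq> C" using S card_C by auto
    then obtain v where "v \<in> C" "S \<subseteq> C - {v}" using S by blast
    then have "x \<in> frontier T" using hull_mono[of S "C - {v}" convex] x unfolding frontier_T by blast
    then show "trace (\<sigma> x) = 0" using \<sigma> unfolding bubbles_def by blast
  qed
  show ?thesis using i(1)
  proof (cases rule: dofs_cases)
    case (Vertex v A)
    have "C \<noteq> {v}" using card_C by auto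
    then obtain w where "w \<in> C" "w \<noteq> v" using Vertex by blast
    then have "\<sigma> v = 0" using e[of "{v, w}" v] Vertex hull_inc[of v "{v, w}"] by simp
    then show ?thesis using Vertex by simp
  next
    case (Edge S p)
    then show ?thesis using e by (simp add: pos_functional_0[OF pos_edge])
  next
    case (Face S b)
    then show ?thesis using f by (simp add: pos_functional_0[OF pos_face])
  next
    case (FaceTrace S q)
    then show ?thesis using f by (simp add: pos_functional_0[OF pos_face])
  next
    case (Interior b)
    then show ?thesis using i(2) by blast
  qed
qed

text \<open>Elements of the moment spaces are functions on the whole space, so vanishing on the hull
  is completed by vanishing off it.\<close>

lemma restr_bub_dense:
  fixes F :: "real^3 \<Rightarrow> 'b::real_normed_vector"
  assumes "S \<subseteq> C" "S \<noteq> {}" "continuous_on (convex hull S) F"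
    and "\<And>x. x \<in> convex hull S \<Longrightarrow> bub S x \<noteq> 0 \<Longrightarrow> F x = 0" "\<And>x. x \<notin> convex hull S \<Longrightarrow> F x = 0"
  shows "F = 0"
proof
  show "F x = 0 x" for x
    using bub_dense[OF order_refl assms(1-4), of x] assms(5)[of x] by (cases "x \<in> convex hull S") auto
qed

lemma independence:
  assumes z: "\<And>\<sigma>. \<sigma> \<in> V \<Longrightarrow> (\<Sum>i\<in>I. c i * dof_form T i \<sigma>) = 0" and "i \<in> I"
  shows "c i = 0"
proof -
  \<comment> \<open>Isolates one block of forms: every other form has a coefficient already shown to
    be zero or vanishes at the test field.\<close>
  have sub: "(\<Sum>b\<in>B. c (g b) * dof_form T (g b) \<sigma>) = 0"
    if "\<sigma> \<in> V" "inj g" "\<And>b. b \<in> B \<Longrightarrow> g b \<in> I"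
      "\<And>i. i \<in> I \<Longrightarrow> i \<notin> g ` B \<Longrightarrow> c i = 0 \<or> dof_form T i \<sigma> = 0" for \<sigma> B and g :: "'b \<Rightarrow> dof"
  proof -
    have "(\<Sum>i\<in>g ` B. c i * dof_form T i \<sigma>) = (\<Sum>i\<in>I. c i * dof_form T i \<sigma>)"
      by (rule sum.mono_neutral_left[OF finite_dofs]) (use that in auto)
    also have "\<dots> = 0" by (rule z[OF that(1)])
    finally show ?thesis
      unfolding sum.reindex[OF inj_on_subset[OF that(2) subset_UNIV]] o_def .
  qed
  have interior: "c (Interior b) = 0" if b: "b \<in> BT" for b
  proof -
    \<comment> \<open>The combination of bubbles with the unknown coefficients is its own test
      field; by \<open>bubble_dofs\<close> only the interior forms see it.\<close>
    define p where "p = (\<Sum>b\<in>BT. c (Interior b) *\<^sub>R b)"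
    have p: "p \<in> bubbles k T" unfolding p_def by (rule basis_of_sum_mem[OF BT])
    have "(\<Sum>b\<in>BT. c (Interior b) * dof_form T (Interior b) p) = 0"
      by (rule sub) (use p bubbles_subset bubble_dofs dofs_intros in \<open>auto simp: inj_def\<close>)
    then have z': "(\<Sum>b\<in>BT. c (Interior b) * (LINT x:T|lborel. (1 *\<^sub>R p x) \<bullet> b x)) = 0" by simp
    show ?thesis
    proof (rule weighted_independent[OF pos_T BT finite_bases(5) _ _ _ _ z'[unfolded p_def] b])
      show "continuous_on T b" if "b \<in> bubbles k T" for b
        using that bubbles_subset V_D(3) by blast
      show "q = 0" if "q \<in> bubbles k T" "\<And>x. x \<in> T \<Longrightarrow> (1::real) \<noteq> 0 \<Longrightarrow> q x = 0" for q
      proof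
        show "q x = 0 x" for x
          using that V_D(2)[of q x] bubbles_subset by (cases "x \<in> T") auto
      qed
    qed simp_all
  qed
  have face: "c (Face (convex hull S) b) = 0"
    if S: "S \<subseteq> C" "card S = 3" and b: "b \<in> BF (convex hull S)" for S b
  proof -
    let ?f = "convex hull S"
    let ?P = "tangent_proj ?f"
    have ne: "S \<noteq> {}" using S(2) by auto
    obtain N where N: "N \<in> sym3" "?P ** N ** ?P = 0" "trace N = 1"
      using ex_normal_matrix[OF tangent_face_neq[OF S]] by blast
    define p where "p = (\<Sum>b\<in>BF ?f. c (Face ?f b) *\<^sub>R b)"
    have p: "p \<in> polys_tensor (k - 3) ?f (sym_tangent ?f)"
      unfolding p_def by (rule basis_of_sum_mem[OF basisF[OF S]])
    then obtain G where G: "G \<in> polys_tensor (k - 3) UNIV (sym_tangent ?f)" "p = restr ?f G"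
      by (rule polys_tensor_extend)
    have Gs: "G x \<in> sym_tangent ?f" for x by (rule polys_tensor_UNIV_D(2)[OF subspace_sym_tangent G(1)])
    \<comment> \<open>\<open>G\<close> is tangential, but its trace need not vanish. Subtracting the
      trace times \<open>N\<close> removes it and keeps the tangential part, so the
      \<open>FaceTrace\<close> forms on this face, whose coefficients are still unknown, vanish at
      the test field.\<close>
    define M where "M x = G x - trace (G x) *\<^sub>R N" for x
    have h: "linear (\<lambda>A. A - trace A *\<^sub>R N)"
      by (intro linearI) (simp_all add: trace_eq_inner inner_add_left algebra_simps)
    have "M \<in> polys_tensor (k - int 3) UNIV sym3"
    proof -
      have "G x - trace (G x) *\<^sub>R N \<in> sym3" for x
        using Gs sym_tangent_subset_sym3 N(1)
        by (intro subspace_diff subspace_scale subspace_sym3) blast+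
      from polys_tensor_linear[OF h G(1) subspace_sym3 this] show ?thesis
        by (simp add: M_def[abs_def])
    qed
    from test_mem[OF S this] have mem: "test_field S M \<in> V" .
    have PM: "?P ** test_field S M x ** ?P = bub S x *\<^sub>R p x" if "x \<in> ?f" for x
    proof -
      have "?P ** M x ** ?P = G x"
        using linear_diff[OF linear_conj[of ?P ?P], of "G x" "trace (G x) *\<^sub>R N"]
          linear_scale[OF linear_conj[of ?P ?P], of "trace (G x)" N] N(2) tangent_proj_conj_id[OF Gs, of x]
        by (simp add: M_def)
      then show ?thesis
        using test_hull[OF S(1) that] linear_scale[OF linear_conj[of ?P ?P], of "bub S x" "M x"] that
        by (simp add: G(2))
    qed
    have tr: "trace (test_field S M x) = 0" if "x \<in> ?f" for x
      using test_hull[OF S(1) that, of S M] N(3)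
      by (simp add: M_def trace_eq_inner inner_diff_left)
    have "(\<Sum>b\<in>BF ?f. c (Face ?f b) * dof_form T (Face ?f b) (test_field S M)) = 0"
    proof (rule sub[OF mem])
      show "inj (Face ?f)" by (simp add: inj_def)
      show "Face ?f b \<in> I" if "b \<in> BF ?f" for b using dofs_intros(3)[OF S that] .
      show "c i = 0 \<or> dof_form T i (test_field S M) = 0" if i: "i \<in> I" "i \<notin> Face ?f ` BF ?f" for i
        using i(1)
      proof (cases rule: dofs_cases)
        case (Vertex v A)
        have "{v} \<noteq> S" using S(2) by auto
        with Vertex show ?thesis by (simp add: test_Vertex S del: dof_form.simps)
      next
        case (Edge S' p)
        have "S' \<noteq> S" using S(2) Edge(3) by auto
        with Edge show ?thesis by (simp add: test_Edge S del: dof_form.simps)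
      next
        case (Face S' b)
        have "S' \<noteq> S" using Face i(2) by blast
        with Face show ?thesis by (simp add: test_Face S del: dof_form.simps)
      next
        case (FaceTrace S' q)
        show ?thesis
        proof (cases "S' = S")
          case True
          then show ?thesis using FaceTrace tr by (simp add: pos_functional_0[OF pos_face])
        next
          case False
          with FaceTrace show ?thesis by (simp add: test_Face S del: dof_form.simps)
        qed
      next
        case (Interior b)
        then show ?thesis using interior by simp
      qed
    qed
    moreover have "dof_form T (Face ?f b) (test_field S M) = face_integral ?f (\<lambda>x. (bub S x *\<^sub>R p x) \<bullet> b x)" for b
      unfolding dof_form.simps by (rule pos_functionalD(1)[OF pos_face[OF S]]) (simp add: PM)
    ultimately have z': "(\<Sum>b\<in>BF ?f. c (Face ?f b) * face_integral ?f (\<lambda>x. (bub S x *\<^sub>R p x) \<bullet> b x)) = 0"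
      by simp
    show ?thesis
    proof (rule weighted_independent[OF pos_face[OF S] basisF[OF S] finite_bases(3)[OF S] _ _ _ _ z'[unfolded p_def] b])
      show cont: "continuous_on ?f b" if "b \<in> polys_tensor (k - 3) ?f (sym_tangent ?f)" for b
        by (rule polys_tensor_continuous[OF that order_refl])
      show "continuous_on ?f (bub S)" by (rule continuous_on_polys[OF bub_polys[OF S(1)]])
      show "0 \<le> bub S x" if "x \<in> ?f" for x by (rule bub_nonneg[OF S(1) S(1) that])
      show "q = 0" if "q \<in> polys_tensor (k - 3) ?f (sym_tangent ?f)" "\<And>x. x \<in> ?f \<Longrightarrow> bub S x \<noteq> 0 \<Longrightarrow> q x = 0" for q
        by (rule restr_bub_dense[OF S(1) ne cont[OF that(1)] that(2) polys_tensor_off[OF that(1)]])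
    qed
  qed
  have face_trace: "c (FaceTrace (convex hull S) b) = 0"
    if S: "S \<subseteq> C" "card S = 3" and b: "b \<in> BR (convex hull S)" for S b
  proof -
    let ?f = "convex hull S"
    let ?P = "tangent_proj ?f"
    have ne: "S \<noteq> {}" using S(2) by auto
    obtain N where N: "N \<in> sym3" "?P ** N ** ?P = 0" "trace N = 1"
      using ex_normal_matrix[OF tangent_face_neq[OF S]] by blast
    define p where "p = (\<Sum>b\<in>BR ?f. c (FaceTrace ?f b) *\<^sub>R b)"
    have p: "p \<in> polys (k - 3) ?f"
      unfolding p_def by (rule basis_of_sum_mem[OF basisR[OF S]])
    then obtain g where g: "g \<in> polys (k - 3) UNIV" "p = restr ?f g"
      by (rule polys_extend)
    \<comment> \<open>\<open>N\<close> has trace one, so on the face the test field has trace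
      \<open>bub S x * g x\<close>. The \<open>Face\<close> coefficients are already known to be
      zero, so only the trace has to be controlled.\<close>
    define M where "M x = g x *\<^sub>R N" for x
    have "M \<in> polys_tensor (k - int 3) UNIV sym3"
      unfolding polys_tensor_def M_def by (rule span_base) (use g N(1) in auto)
    from test_mem[OF S this] have mem: "test_field S M \<in> V" .
    have tr: "trace (test_field S M x) = bub S x *\<^sub>R p x" if "x \<in> ?f" for x
      using test_hull[OF S(1) that, of S M] N(3) that
      by (simp add: M_def trace_eq_inner g(2))
    have "(\<Sum>b\<in>BR ?f. c (FaceTrace ?f b) * dof_form T (FaceTrace ?f b) (test_field S M)) = 0"
    proof (rule sub[OF mem])
      show "inj (FaceTrace ?f)" by (simp add: inj_def)
      show "FaceTrace ?f b \<in> I" if "b \<in> BR ?f" for b using dofs_intros(4)[OF S that] .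
      show "c i = 0 \<or> dof_form T i (test_field S M) = 0" if i: "i \<in> I" "i \<notin> FaceTrace ?f ` BR ?f" for i
        using i(1)
      proof (cases rule: dofs_cases)
        case (Vertex v A)
        have "{v} \<noteq> S" using S(2) by auto
        with Vertex show ?thesis by (simp add: test_Vertex S del: dof_form.simps)
      next
        case (Edge S' p)
        have "S' \<noteq> S" using S(2) Edge(3) by auto
        with Edge show ?thesis by (simp add: test_Edge S del: dof_form.simps)
      next
        case (Face S' b)
        then show ?thesis using face by simp
      next
        case (FaceTrace S' q)
        have "S' \<noteq> S" using FaceTrace i(2) by blast
        with FaceTrace show ?thesis by (simp add: test_Face S del: dof_form.simps)
      next
        case (Interior b)
        then show ?thesis using interior by simp
      qed
    qed
    moreover have "dof_form T (FaceTrace ?f b) (test_field S M) = face_integral ?f (\<lambda>x. (bub S x *\<^sub>R p x) \<bullet> b x)" for b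
      unfolding dof_form.simps by (rule pos_functionalD(1)[OF pos_face[OF S]]) (simp add: tr)
    ultimately have z': "(\<Sum>b\<in>BR ?f. c (FaceTrace ?f b) * face_integral ?f (\<lambda>x. (bub S x *\<^sub>R p x) \<bullet> b x)) = 0"
      by simp
    show ?thesis
    proof (rule weighted_independent[OF pos_face[OF S] basisR[OF S] finite_bases(4)[OF S] _ _ _ _ z'[unfolded p_def] b])
      show cont: "continuous_on ?f b" if "b \<in> polys (k - 3) ?f" for b
        by (rule polys_continuous[OF that order_refl])
      show "continuous_on ?f (bub S)" by (rule continuous_on_polys[OF bub_polys[OF S(1)]])
      show "0 \<le> bub S x" if "x \<in> ?f" for x by (rule bub_nonneg[OF S(1) S(1) that])
      show "q = 0" if "q \<in> polys (k - 3) ?f" "\<And>x. x \<in> ?f \<Longrightarrow> bub S x \<noteq> 0 \<Longrightarrow> q x = 0" for q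
        by (rule restr_bub_dense[OF S(1) ne cont[OF that(1)] that(2) polys_off[OF that(1)]])
    qed
  qed
  have edge: "c (Edge (convex hull S) b) = 0"
    if S: "S \<subseteq> C" "card S = 2" and b: "b \<in> BE (convex hull S)" for S b
  proof -
    let ?e = "convex hull S"
    have ne: "S \<noteq> {}" using S(2) by auto
    define p where "p = (\<Sum>b\<in>BE ?e. c (Edge ?e b) *\<^sub>R b)"
    have p: "p \<in> polys_tensor (k - 2) ?e sym3"
      unfolding p_def by (rule basis_of_sum_mem[OF basisE[OF S]])
    then obtain M where M: "M \<in> polys_tensor (k - 2) UNIV sym3" "p = restr ?e M"
      by (rule polys_tensor_extend)
    have mem: "test_field S M \<in> V" using test_mem[OF S] M(1) by simp
    have "(\<Sum>b\<in>BE ?e. c (Edge ?e b) * dof_form T (Edge ?e b) (test_field S M)) = 0"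
    proof (rule sub[OF mem])
      show "inj (Edge ?e)" by (simp add: inj_def)
      show "Edge ?e b \<in> I" if "b \<in> BE ?e" for b using dofs_intros(2)[OF S that] .
      show "c i = 0 \<or> dof_form T i (test_field S M) = 0" if i: "i \<in> I" "i \<notin> Edge ?e ` BE ?e" for i
        using i(1)
      proof (cases rule: dofs_cases)
        case (Vertex v A)
        have "{v} \<noteq> S" using S(2) by auto
        with Vertex show ?thesis by (simp add: test_Vertex S del: dof_form.simps)
      next
        case (Edge S' p)
        have "S' \<noteq> S" using Edge i(2) by blast
        with Edge show ?thesis by (simp add: test_Edge S del: dof_form.simps)
      next
        \<comment> \<open>Faces through the edge may see the test field; their coefficients vanish
          by the previous stages.\<close>
        case (Face S' b)
        then show ?thesis using face by simp
      next
        case (FaceTrace S' q)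
        then show ?thesis using face_trace by simp
      next
        case (Interior b)
        then show ?thesis using interior by simp
      qed
    qed
    moreover have "dof_form T (Edge ?e b) (test_field S M) = edge_integral ?e (\<lambda>x. (bub S x *\<^sub>R p x) \<bullet> b x)" for b
      unfolding dof_form.simps
      by (rule pos_functionalD(1)[OF pos_edge[OF S]]) (simp add: test_hull[OF S(1)] M(2))
    ultimately have z': "(\<Sum>b\<in>BE ?e. c (Edge ?e b) * edge_integral ?e (\<lambda>x. (bub S x *\<^sub>R p x) \<bullet> b x)) = 0"
      by simp
    show ?thesis
    proof (rule weighted_independent[OF pos_edge[OF S] basisE[OF S] finite_bases(2)[OF S] _ _ _ _ z'[unfolded p_def] b])
      show cont: "continuous_on ?e b" if "b \<in> polys_tensor (k - 2) ?e sym3" for b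
        by (rule polys_tensor_continuous[OF that order_refl])
      show "continuous_on ?e (bub S)" by (rule continuous_on_polys[OF bub_polys[OF S(1)]])
      show "0 \<le> bub S x" if "x \<in> ?e" for x by (rule bub_nonneg[OF S(1) S(1) that])
      show "q = 0" if "q \<in> polys_tensor (k - 2) ?e sym3" "\<And>x. x \<in> ?e \<Longrightarrow> bub S x \<noteq> 0 \<Longrightarrow> q x = 0" for q
        by (rule restr_bub_dense[OF S(1) ne cont[OF that(1)] that(2) polys_tensor_off[OF that(1)]])
    qed
  qed
  have vertex: "c (Vertex v A) = 0" if v: "v \<in> C" and A: "A \<in> BV v" for v A
  proof -
    define B where "B = (\<Sum>A\<in>BV v. c (Vertex v A) *\<^sub>R A)"
    have B: "B \<in> sym3" unfolding B_def by (rule basis_of_sum_mem[OF basisV[OF v]])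
    \<comment> \<open>This is where \<open>k \<ge> 1\<close> enters: a constant must have degree at
      most \<open>k - 1\<close>. The factor 1 displays the generator shape of
      \<open>polys_tensor\<close>.\<close>
    have "(\<lambda>x. 1 *\<^sub>R B) \<in> polys_tensor (k - int 1) UNIV sym3"
      unfolding polys_tensor_def
      by (rule span_base) (use polys_const[of "k - int 1" 1] k B in force)
    from test_mem[of "{v}", OF _ _ this] have mem: "test_field {v} (\<lambda>x. 1 *\<^sub>R B) \<in> V" using v by simp
    have tv: "test_field {v} (\<lambda>x. 1 *\<^sub>R B) v = B"
      using test_hull[of "{v}" v] lam_vertex[OF v v] v by (simp add: bub_def)
    have "(\<Sum>A\<in>BV v. c (Vertex v A) * dof_form T (Vertex v A) (test_field {v} (\<lambda>x. 1 *\<^sub>R B))) = 0"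
    proof (rule sub[OF mem])
      show "inj (Vertex v)" by (simp add: inj_def)
      show "Vertex v A \<in> I" if "A \<in> BV v" for A using dofs_intros(1)[OF v that] .
      show "c i = 0 \<or> dof_form T i (test_field {v} (\<lambda>x. 1 *\<^sub>R B)) = 0" if i: "i \<in> I" "i \<notin> Vertex v ` BV v" for i
        using i(1)
      proof (cases rule: dofs_cases)
        case (Vertex w A)
        have "{w} \<noteq> {v}" using Vertex i(2) by blast
        with Vertex show ?thesis using v by (simp add: test_Vertex del: dof_form.simps)
      next
        case (Edge S' p)
        then show ?thesis using edge by simp
      next
        case (Face S' b)
        then show ?thesis using face by simp
      next
        case (FaceTrace S' q)
        then show ?thesis using face_trace by simp
      next
        case (Interior b)
        then show ?thesis using interior by simp
      qed
    qed
    then have "(\<Sum>A\<in>BV v. c (Vertex v A) * (B \<bullet> A)) = 0" by (simp add: tv[simplified])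
    \<comment> \<open>The coefficients are those that define \<open>B\<close>, so the sum is the
      squared norm of \<open>B\<close>.\<close>
    then have "B \<bullet> (\<Sum>A\<in>BV v. c (Vertex v A) *\<^sub>R A) = 0" by (simp add: inner_sum_right)
    then have "B = 0" unfolding B_def[symmetric] by simp
    then show ?thesis unfolding B_def
      by (rule basis_of_sum_zero[OF basisV[OF v] finite_bases(1)[OF v] _ A])
  qed
  from \<open>i \<in> I\<close> show ?thesis
    by (cases rule: dofs_cases) (simp_all add: interior face face_trace edge vertex)
qed

lemma unisolvent_dofs: "unisolvent I (dof_form T) V"
proof (rule unisolventI[OF subspace_polys_tensor finite_dofs dof_form_linear])
  show "\<sigma> = 0" if "\<sigma> \<in> V" "\<And>i. i \<in> I \<Longrightarrow> dof_form T i \<sigma> = 0" for \<sigma>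
    using that by (rule kernel)
  show "c i = 0" if "\<And>\<sigma>. \<sigma> \<in> V \<Longrightarrow> (\<Sum>i\<in>I. c i * dof_form T i \<sigma>) = 0" "i \<in> I" for c i
    using that by (rule independence)
qed

end

theorem proposition4p4:
  fixes k :: int and T :: "(real^3) set"
    and BV :: "real^3 \<Rightarrow> (real^3^3) set"
    and BE BF :: "(real^3) set \<Rightarrow> (real^3 \<Rightarrow> real^3^3) set"
    and BR :: "(real^3) set \<Rightarrow> (real^3 \<Rightarrow> real) set"
    and BT :: "(real^3 \<Rightarrow> real^3^3) set"
  assumes "k \<ge> 1" and "3 simplex T"
    and "\<And>x. x extreme_point_of T \<Longrightarrow> basis_of (BV x) sym3"
    and "\<And>e. e edge_of T \<Longrightarrow> basis_of (BE e) (polys_tensor (k - 2) e sym3)"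
    and "\<And>f. f facet_of T \<Longrightarrow> basis_of (BF f) (polys_tensor (k - 3) f (sym_tangent f))"
    and "\<And>f. f facet_of T \<Longrightarrow> basis_of (BR f) (polys (k - 3) f)"
    and "basis_of BT (bubbles k T)"
  shows "unisolvent (dofs T BV BE BF BR BT) (dof_form T) (polys_tensor k T sym3)"
proof -
  obtain C where C: "\<not> affine_dependent C" "card C = 4" "T = convex hull C"
    using assms(2) unfolding simplex_def by auto
  obtain lam where "barycentric C lam" using ex_barycentric[OF C(1)] by blast
  then interpret barycentric C lam .
  interpret dof_bases C lam T k BV BE BF BR BT
    by unfold_locales (fact C assms)+
  show ?thesis by (rule unisolvent_dofs)
qed

end
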